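(* Let $\boldsymbol\beta\in\mathbb{G}_m^2$ be non-torsion, and let $\boldsymbol F:\mathbb{N}_0\to\mathbb{G}_m^2$ be a function satisfying $$\limsup_{n\to\infty}\frac1n\,d\big(\boldsymbol F(n),\boldsymbol\beta^n\big)<\frac19\,h(\boldsymbol\beta).$$ Then $\#\big(\operatorname{im}(\boldsymbol F)\cap\Pi\big)<\infty$.
   Context: $\mathbb{G}_m^2$ denotes the group $(\overline{\mathbb{Q}}^* )^2$ with coordinatewise multiplication; an element is non-torsion if it is not of finite order in this group. $h:\overline{\mathbb{Q}}^*\to\mathbb{R}_{\ge0}$ is the absolute logarithmic Weil height, and for $\boldsymbol x=(x_1,x_2)\in\mathbb{G}_m^2$ one sets $h(\boldsymbol x):=\max\{h(x_1),h(x_2)\}$. For $\boldsymbol x,\boldsymbol y\in\mathbb{G}_m^2$, $d(\boldsymbol x,\boldsymbol y):=h(\boldsymbol x\boldsymbol y^{-1})$. Finally $\Pi:=\{\boldsymbol x\in(\overline{\mathbb{Q}}^* )^2:x_1+x_2=1\}$, and $\mathbb{N}_0$ is the set of non-negative integers. *)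

theory Defs
  imports Complex_Main "HOL-Algebra.Group"
    "HOL-Computational_Algebra.Polynomial_Factorial"
    "HOL-Library.Liminf_Limsup" "HOL-Library.Extended_Real"
begin

text \<open>
  The algebraic closure of \<open>\<rat>\<close> is taken inside \<open>\<complex>\<close>, as the set of \<open>z\<close> with
  \<^term>\<open>algebraic z\<close>.
\<close>

definition Gm :: "complex monoid" where
  "Gm = \<lparr>carrier = {z. algebraic z \<and> z \<noteq> 0}, monoid.mult = (*), one = 1\<rparr>"

definition Gm2 :: "(complex \<times> complex) monoid" where
  "Gm2 = Gm \<times>\<times> Gm"

definition non_torsion :: "complex \<times> complex \<Rightarrow> bool" where
  "non_torsion x \<longleftrightarrow> \<not> (\<exists>n::nat. n > 0 \<and> x [^]\<^bsub>Gm2\<^esub> n = \<one>\<^bsub>Gm2\<^esub>)"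

text \<open>
  The primitive minimal polynomial over \<open>\<int>\<close>. Irreducibility in \<open>\<int>[X]\<close> of a polynomial of
  positive degree includes that its coefficients have no common factor.
\<close>

definition is_min_int_poly :: "complex \<Rightarrow> int poly \<Rightarrow> bool" where
  "is_min_int_poly z p \<longleftrightarrow>
     irreducible p \<and> lead_coeff p > 0 \<and> poly (map_poly of_int p) z = 0"

definition min_int_poly :: "complex \<Rightarrow> int poly" where
  "min_int_poly z = (THE p. is_min_int_poly z p)"

definition conjugates :: "complex \<Rightarrow> complex set" where
  "conjugates z = {w. poly (map_poly of_int (min_int_poly z)) w = 0}"

text \<open>
  The absolute logarithmic Weil height, in its classical form
  \<open>h(z) = 1/d (log a\<^sub>0 + \<Sum> log max(1, |z\<^sub>i|))\<close>, where \<open>a\<^sub>0\<close> and \<open>d\<close> are the leading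
  coefficient and the degree of the primitive minimal polynomial of \<open>z\<close> over \<open>\<int>\<close>, and the
  \<open>z\<^sub>i\<close> are its roots. The sum over a set of roots loses nothing, as irreducible polynomials in
  characteristic 0 have only simple roots. The term \<open>log a\<^sub>0\<close> is the contribution of the
  non-archimedean places.
\<close>

definition weil_height :: "complex \<Rightarrow> real" where
  "weil_height z =
     (ln (real_of_int (lead_coeff (min_int_poly z))) + (\<Sum>w\<in>conjugates z. ln (max 1 (cmod w))))
     / real (degree (min_int_poly z))"

definition height2 :: "complex \<times> complex \<Rightarrow> real" where
  "height2 x = max (weil_height (fst x)) (weil_height (snd x))"

definition height_dist :: "complex \<times> complex \<Rightarrow> complex \<times> complex \<Rightarrow> real" where
  "height_dist x y = height2 (x \<otimes>\<^bsub>Gm2\<^esub> inv\<^bsub>Gm2\<^esub> y)"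

definition unit_line :: "(complex \<times> complex) set" where
  "unit_line = {x \<in> carrier Gm2. fst x + snd x = 1}"

subsection \<open>Well-definedness\<close>

lemma map_poly_of_int_mult:
  "map_poly of_int (p * q) = (map_poly of_int p * map_poly of_int q :: complex poly)"
  by (rule poly_eqI) (simp add: coeff_map_poly coeff_mult)

lemma irreducible_int_poly_root_exists:
  fixes p :: "int poly" and z :: complex
  assumes "p \<noteq> 0" "poly (map_poly of_int p) z = 0"
  shows "\<exists>q. irreducible q \<and> degree q \<le> degree p \<and> poly (map_poly of_int q) z = 0"
  using assms
proof (induction p rule: prime_divisors_induct)
  case (unit x)
  then obtain c where c: "x = [:c:]" "c \<noteq> 0"
    by (metis is_unit_polyE not_is_unit_0)
  have "map_poly of_int [:c:] = [:of_int c :: complex:]"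
    using c(2) by (simp add: map_poly_pCons)
  with unit.prems(2) c show ?case by simp
next
  case (factor p x)
  have nz: "x \<noteq> 0" "p \<noteq> 0" using factor.prems by auto
  then have deg: "degree (p * x) = degree p + degree x" by (simp add: degree_mult_eq)
  from factor.prems consider
    "poly (map_poly of_int p) z = 0" | "poly (map_poly of_int x) z = 0"
    by (auto simp: map_poly_of_int_mult)
  then show ?case
  proof cases
    case 1
    then show ?thesis
      using prime_elem_imp_irreducible[OF prime_imp_prime_elem[OF factor.hyps(1)]] deg
      by (intro exI[of _ p]) simp
  next
    case 2
    with factor.IH nz obtain q where
      "irreducible q" "degree q \<le> degree x" "poly (map_poly of_int q) z = 0" by blast
    then show ?thesis
      using deg by (intro exI[of _ q]) simp
  qed
qed simp

lemma is_min_int_poly_ex1: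
  assumes "algebraic z"
  shows "\<exists>!p. is_min_int_poly z p"
proof -
  let ?R = "\<lambda>p. poly (map_poly of_int p) z = 0"
  obtain p0 where "p0 \<noteq> 0 \<and> ?R p0"
    using algebraicE'[OF assms] by metis
  then obtain p where p: "p \<noteq> 0" "?R p"
    and least: "\<And>f. f \<noteq> 0 \<Longrightarrow> ?R f \<Longrightarrow> degree p \<le> degree f"
    using ex_has_least_nat[of "\<lambda>p. p \<noteq> 0 \<and> ?R p" p0 degree] by blast
  obtain m where m: "irreducible m" "?R m" and "degree m \<le> degree p"
    using irreducible_int_poly_root_exists[OF p] by blast
  with least have least: "\<And>f. f \<noteq> 0 \<Longrightarrow> ?R f \<Longrightarrow> degree m \<le> degree f"
    by (meson le_trans)
  have m0: "m \<noteq> 0" using m(1) by auto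
  have degm: "degree m \<noteq> 0"
  proof
    assume "degree m = 0"
    then obtain c where "m = [:c:]" by (metis degree_eq_zeroE)
    with m(2) m0 show False by (auto simp: map_poly_pCons)
  qed
  have dvd: "m dvd f" if f: "?R f" for f
  proof -
    obtain a q where aq: "a \<noteq> 0" "smult a f = m * q + pseudo_mod f m"
      using pseudo_mod(1)[OF m0] by blast
    have "map_poly of_int (smult a f) =
        map_poly of_int m * map_poly of_int q + (map_poly of_int (pseudo_mod f m) :: complex poly)"
      unfolding aq(2) map_poly_of_int_mult[symmetric] by (rule poly_eqI) (simp add: coeff_map_poly)
    moreover have "map_poly of_int (smult a f) = (smult (of_int a) (map_poly of_int f) :: complex poly)"
      by (rule poly_eqI) (simp add: coeff_map_poly)
    ultimately have "?R (pseudo_mod f m)"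
      using f m(2) by (metis (no_types, lifting) add_0 mult_zero_left mult_zero_right poly_add poly_mult poly_smult)
    with pseudo_mod(2)[OF m0] least have "pseudo_mod f m = 0"
      by (metis leD)
    with aq have "m dvd [:a:] * f" by simp
    moreover have "\<not> m dvd [:a:]"
      using aq(1) degm dvd_imp_degree_le[of m "[:a:]"] by auto
    ultimately show ?thesis
      using irreducible_imp_prime_elem[OF m(1)] prime_elem_dvd_multD by blast
  qed
  have norm: "normalize f = f" if "lead_coeff f > 0" for f :: "int poly"
    using that by (simp add: normalize_poly_eq_map_poly)
  have assoc: "normalize f = normalize m" if f: "irreducible f" "?R f" for f
    using dvd[OF f(2)] f(1) m(1)
    by (meson associatedI irreducibleD' irreducible_not_unit)
  show ?thesis
  proof (rule ex1I)
    have "lead_coeff (normalize m) > 0"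
      using m0 linorder_less_linear[of "lead_coeff m" 0]
      by (auto simp: normalize_poly_eq_map_poly lead_coeff_map_poly_nz sgn_if)
    moreover have "?R (normalize m)"
    proof -
      obtain k where "normalize m = m * k" by (metis dvd_normalize_iff dvd_refl dvdE)
      then show ?thesis using m(2) by (simp add: map_poly_of_int_mult)
    qed
    ultimately show "is_min_int_poly z (normalize m)"
      using m(1) by (simp add: is_min_int_poly_def)
  next
    show "f = normalize m" if "is_min_int_poly z f" for f
      using that assoc norm unfolding is_min_int_poly_def by metis
  qed
qed

lemma vector_space_of_rat: "vector_space (\<lambda>(q::rat) (x::complex). of_rat q * x)"
  by standard (auto simp: algebra_simps of_rat_add of_rat_mult)

lemma algebraic_mult:
  fixes x y :: complex
  assumes "algebraic x" "algebraic y"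
  shows "algebraic (x * y)"
proof -
  interpret vector_space "\<lambda>(q::rat) (x::complex). of_rat q * x"
    by (rule vector_space_of_rat)
  have pow: "\<exists>n. \<forall>c. x ^ n * c \<in> span ((\<lambda>i. x ^ i * c) ` {..<n})" if "algebraic x" for x
  proof -
    obtain p where p: "\<And>i. coeff p i \<in> \<rat>" "p \<noteq> 0" "poly p x = 0"
      using \<open>algebraic x\<close> unfolding algebraic_altdef by blast
    define n where "n = degree p"
    define r where "r i = (SOME q. of_rat q = - coeff p i / lead_coeff p)" for i
    have r: "of_rat (r i) = - coeff p i / lead_coeff p" for i
    proof -
      have "- coeff p i / lead_coeff p \<in> \<rat>" using p(1) by simp
      then show ?thesis unfolding r_def by (metis (mono_tags, lifting) Rats_cases someI)
    qed
    have "x ^ n = (\<Sum>i<n. of_rat (r i) * x ^ i)"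
    proof -
      have "0 = (\<Sum>i<n. coeff p i * x ^ i) + lead_coeff p * x ^ n"
        using p(3) by (simp add: poly_altdef n_def lessThan_Suc_atMost[symmetric])
      then have "x ^ n = - (\<Sum>i<n. coeff p i * x ^ i) / lead_coeff p"
        using p(2) by (simp add: field_simps eq_neg_iff_add_eq_0 add.commute)
      then show ?thesis
        by (simp add: r sum_negf sum_divide_distrib)
    qed
    then have "x ^ n * c = (\<Sum>i<n. of_rat (r i) * (x ^ i * c))" for c
      by (simp add: sum_distrib_right mult.assoc)
    then have "x ^ n * c \<in> span ((\<lambda>i. x ^ i * c) ` {..<n})" for c
      by (auto intro!: span_sum span_scale intro: span_base)
    then show ?thesis by blast
  qed
  obtain m where m: "\<And>c. x ^ m * c \<in> span ((\<lambda>i. x ^ i * c) ` {..<m})"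
    using pow[OF assms(1)] by blast
  obtain n where n: "\<And>c. y ^ n * c \<in> span ((\<lambda>i. y ^ i * c) ` {..<n})"
    using pow[OF assms(2)] by blast
  define B where "B = (\<lambda>(i, j). x ^ i * y ^ j) ` ({..<m} \<times> {..<n})"
  have closed: "a * w \<in> span B" if "\<And>b. b \<in> B \<Longrightarrow> a * b \<in> span B" "w \<in> span B" for a w
    using that(2)
  proof (induction rule: span_induct_alt)
    case base
    then show ?case by (simp add: span_zero)
  next
    case (step c b w)
    have "a * (of_rat c * b + w) = of_rat c * (a * b) + a * w" by (simp add: algebra_simps)
    then show ?case using step that(1) by (simp add: span_add span_scale)
  qed
  have "x * b \<in> span B" if "b \<in> B" for b
  proof -
    obtain i j where ij: "b = x ^ i * y ^ j" "i < m" "j < n" using \<open>b \<in> B\<close> by (auto simp: B_def)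
    show ?thesis
    proof (cases "Suc i < m")
      case True
      then have "x ^ Suc i * y ^ j \<in> B" using ij by (force simp: B_def)
      then show ?thesis using ij by (simp add: span_base mult.assoc)
    next
      case False
      then have "x * b = x ^ m * y ^ j" using ij by (metis Suc_lessI mult.assoc power_Suc)
      moreover have "(\<lambda>i. x ^ i * y ^ j) ` {..<m} \<subseteq> B" using ij by (force simp: B_def)
      ultimately show ?thesis using m[of "y ^ j"] span_mono by (metis subsetD)
    qed
  qed
  note x_closed = closed[OF this]
  have "y * b \<in> span B" if "b \<in> B" for b
  proof -
    obtain i j where ij: "b = x ^ i * y ^ j" "i < m" "j < n" using \<open>b \<in> B\<close> by (auto simp: B_def)
    show ?thesis
    proof (cases "Suc j < n")
      case True
      then have "x ^ i * y ^ Suc j \<in> B" using ij by (force simp: B_def)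
      then show ?thesis using ij by (simp add: span_base mult.left_commute)
    next
      case False
      then have "y * b = y ^ n * x ^ i" using ij by (metis Suc_lessI mult.commute mult.left_commute power_Suc)
      moreover have "(\<lambda>j. y ^ j * x ^ i) ` {..<n} \<subseteq> B" using ij by (force simp: B_def mult.commute)
      ultimately show ?thesis using n[of "x ^ i"] span_mono by (metis subsetD)
    qed
  qed
  note y_closed = closed[OF this]
  have "1 \<in> span B"
  proof (cases "m = 0 \<or> n = 0")
    case True
    then show ?thesis using m[of 1] n[of 1] by (auto simp: span_zero)
  next
    case False
    then have "x ^ 0 * y ^ 0 \<in> B" unfolding B_def by (intro image_eqI[of _ _ "(0, 0)"]) auto
    then show ?thesis by (simp add: span_base)
  qed
  then have pow_in: "(x * y) ^ k \<in> span B" for k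
    by (induction k) (auto simp: mult.assoc intro: x_closed y_closed)
  have finB: "finite B" by (simp add: B_def)
  show ?thesis
  proof (cases "inj (\<lambda>k. (x * y) ^ k)")
    case True
    define S where "S = (\<lambda>k. (x * y) ^ k) ` {..card B}"
    have "card S = Suc (card B)"
      unfolding S_def using True by (subst card_image) (auto intro: inj_on_subset)
    moreover have "S \<subseteq> span B" using pow_in by (auto simp: S_def)
    ultimately have "dependent S"
      using independent_span_bound[OF finB, of S] by auto
    moreover have finS: "finite S" by (simp add: S_def)
    ultimately obtain u where u: "(\<Sum>v\<in>S. of_rat (u v) * v) = 0" "\<exists>v\<in>S. u v \<noteq> 0"
      using dependent_finite by blast
    define p :: "complex poly" where
      "p = (\<Sum>k\<le>card B. monom (of_rat (u ((x * y) ^ k))) k)"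
    have co: "coeff p i = (if i \<le> card B then of_rat (u ((x * y) ^ i)) else 0)" for i
      by (simp add: p_def coeff_sum)
    have "poly p (x * y) = (\<Sum>v\<in>S. of_rat (u v) * v)"
      unfolding S_def using True
      by (subst sum.reindex) (auto simp: p_def poly_sum poly_monom intro: inj_on_subset)
    moreover have "p \<noteq> 0"
    proof -
      obtain k where "k \<le> card B" "u ((x * y) ^ k) \<noteq> 0" using u(2) by (auto simp: S_def)
      then have "coeff p k \<noteq> 0" by (simp add: co)
      then show ?thesis by auto
    qed
    ultimately show ?thesis
      using u(1) by (intro algebraicI'[of p]) (auto simp: co)
  next
    case False
    then obtain i j where ij: "i \<noteq> j" "(x * y) ^ i = (x * y) ^ j" by (auto simp: inj_def)
    define p :: "complex poly" where "p = monom 1 i - monom 1 j"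
    have "coeff p i = 1" using ij by (simp add: p_def)
    then have "p \<noteq> 0" by auto
    then show ?thesis
      using ij by (intro algebraicI'[of p]) (auto simp: p_def poly_monom)
  qed
qed

lemma comm_group_Gm: "comm_group Gm"
proof (rule comm_groupI)
  fix z assume "z \<in> carrier Gm"
  then have "inverse z \<in> carrier Gm" "inverse z \<otimes>\<^bsub>Gm\<^esub> z = \<one>\<^bsub>Gm\<^esub>"
    by (auto simp: Gm_def)
  then show "\<exists>w\<in>carrier Gm. w \<otimes>\<^bsub>Gm\<^esub> z = \<one>\<^bsub>Gm\<^esub>" by blast
qed (auto simp: Gm_def algebraic_mult)

lemma group_Gm2: "group Gm2"
  unfolding Gm2_def using comm_group_Gm by (intro DirProd_group comm_group.axioms(2))

end

theory Submission
  imports Defs "HOL-Computational_Algebra.Computational_Algebra"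
begin

text \<open>
  If \<open>F n\<close> and \<open>F n'\<close> both lie on the line and \<open>n'\<close> is much larger than \<open>n\<close>, then with
  \<open>2N \<approx> n'/n\<close> the coordinates \<open>x, y\<close> of \<open>F n\<close> satisfy \<open>x + y = 1\<close> and
  \<open>\<epsilon> x\<^sup>2\<^sup>N + \<delta> y\<^sup>2\<^sup>N = 1\<close>, where \<open>\<epsilon>\<close> and \<open>\<delta>\<close> have height at most about \<open>2c n'\<close> if the distances in
  the hypothesis are at most \<open>c n\<close>. A Pade approximation to \<open>1, z\<^sup>2\<^sup>N, (1 - z)\<^sup>2\<^sup>N\<close> gives a second linear
  relation, with coefficients of height about \<open>N h(x)\<close>, and elimination yields
  \<open>N h(x) \<le> h(\<epsilon>) + h(\<delta>) + O(N)\<close>. As \<open>h(x)\<close> is at least about \<open>(h(\<beta>) - c) n\<close>, this forces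
  \<open>9c \<ge> h(\<beta>)\<close> in the limit.

  The height inequalities are obtained without places: for \<open>\<alpha> \<in> \<rat>(\<theta>)\<close> the height is read off the
  product of \<open>X - \<sigma>(\<alpha>)\<close> over the conjugates of \<open>\<theta>\<close>, and the non-archimedean part is controlled by
  the integrality of \<open>a \<Prod>\<^sub>S \<alpha>\<^sub>i\<close>, for any set \<open>S\<close> of roots of an integer polynomial with leading
  coefficient \<open>a\<close>.
\<close>

section \<open>Integral elements\<close>

text \<open>The constant 9 is 1 + 8. The lower bound for h(x) loses c n, while each of \<epsilon>
  and \<delta> costs c n' for \<open>F n'\<close> and 2N c n for the 2N-th power of
  \<open>F n\<close>, about 4c N n together. The gain comes from x^(2N), whose height 2N h(x)
  exceeds the N h(x) paid for Pade coefficients of degree N. This balance holds only if, in the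
  quotient of minors, x is charged its degree N and \<epsilon>, \<delta> their degree 1 once for
  numerator and denominator together; subadditivity of the height would charge them once per term.
  Hence the central inequality concerns rational functions in three variables with a common set of
  monomials (\<open>weil_height_rational_function\<close>). A single Pade form may be proportional
  to the unit equation at the given point, which is why two forms with nonzero determinant are
  needed. The order of choices matters: n is fixed first, large enough to absorb the O(N), and n' is
  then taken large in terms of n, so that the division remainder of n' by 2n does no harm.\<close>

interpretation zmod: module "\<lambda>(n::int) (z::complex). of_int n * z"
  by standard (auto simp: algebra_simps)

interpretation qvec: vector_space "\<lambda>(q::rat) (z::complex). of_rat q * z"
  by (rule vector_space_of_rat)

text \<open>Algebraic integers, described by a finitely generated subgroup of the complex numbers
  that contains 1 and is stable under multiplication by z. Closure under sums and products then
  needs only a common stable group, and no polynomials.\<close>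

definition integral_el :: "complex \<Rightarrow> bool" where
  "integral_el z \<longleftrightarrow>
     (\<exists>B. finite B \<and> 1 \<in> zmod.span B \<and> (\<forall>b\<in>B. z * b \<in> zmod.span B))"

lemma zspan_mult_closed:
  assumes "\<And>b. b \<in> B \<Longrightarrow> z * b \<in> zmod.span B'" "w \<in> zmod.span B"
  shows "z * w \<in> zmod.span B'"
  using assms(2)
proof (induction rule: zmod.span_induct_alt)
  case base
  then show ?case by (simp add: zmod.span_zero)
next
  case (step c b w)
  have "z * (of_int c * b + w) = of_int c * (z * b) + z * w" by (simp add: algebra_simps)
  then show ?case using step assms(1) zmod.span_add zmod.span_scale by metis
qed

lemma zspan_mult:
  assumes "x \<in> zmod.span A" "y \<in> zmod.span B"
  shows "x * y \<in> zmod.span ((\<lambda>(a, b). a * b) ` (A \<times> B))"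
proof -
  have "a * y \<in> zmod.span ((\<lambda>(a, b). a * b) ` (A \<times> B))" if "a \<in> A" for a
    using that by (intro zspan_mult_closed[OF _ assms(2)] zmod.span_base) force
  then have "y * x \<in> zmod.span ((\<lambda>(a, b). a * b) ` (A \<times> B))"
    by (intro zspan_mult_closed[OF _ assms(1)]) (simp add: mult.commute)
  then show ?thesis by (simp add: mult.commute)
qed

text \<open>The products of generators of two such groups generate a group stable under both
  multiplications, since each multiplication acts on one factor only.\<close>

lemma common_stable_lattice:
  assumes "finite C" "\<And>c. c \<in> C \<Longrightarrow> integral_el c"
  shows "\<exists>B. finite B \<and> 1 \<in> zmod.span B \<and> (\<forall>c\<in>C. \<forall>b\<in>B. c * b \<in> zmod.span B)"
  using assms
proof (induction C rule: finite_induct)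
  case empty
  show ?case by (rule exI[of _ "{1}"]) (auto intro: zmod.span_base)
next
  case (insert z C)
  obtain B where B: "finite B" "1 \<in> zmod.span B" "\<forall>c\<in>C. \<forall>b\<in>B. c * b \<in> zmod.span B"
    using insert.IH insert.prems by auto
  obtain A where A: "finite A" "1 \<in> zmod.span A" "\<forall>b\<in>A. z * b \<in> zmod.span A"
    using insert.prems[of z] unfolding integral_el_def by auto
  let ?P = "(\<lambda>(a, b). a * b) ` (A \<times> B)"
  have "1 \<in> zmod.span ?P" using zspan_mult[OF A(2) B(2)] by simp
  moreover have "z * (a * b) \<in> zmod.span ?P" if "a \<in> A" "b \<in> B" for a b
    using zspan_mult[of "z * a" A b B] A(3) that zmod.span_base[of b B] by (simp add: mult.assoc)
  moreover have "c * (a * b) \<in> zmod.span ?P" if "c \<in> C" "a \<in> A" "b \<in> B" for a b c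
    using zspan_mult[of a A "c * b" B] B(3) that zmod.span_base[of a A] by (simp add: mult.left_commute)
  ultimately show ?case using A(1) B(1) by (intro exI[of _ ?P]) auto
qed

lemma integral_el_add:
  assumes "integral_el x" "integral_el y"
  shows "integral_el (x + y)"
proof -
  obtain B where "finite B" "1 \<in> zmod.span B" "\<forall>c\<in>{x, y}. \<forall>b\<in>B. c * b \<in> zmod.span B"
    using common_stable_lattice[of "{x, y}"] assms by auto
  then show ?thesis
    unfolding integral_el_def by (intro exI[of _ B]) (auto simp: distrib_right zmod.span_add)
qed

lemma integral_el_mult:
  assumes "integral_el x" "integral_el y"
  shows "integral_el (x * y)"
proof -
  obtain B where "finite B" "1 \<in> zmod.span B" "\<forall>c\<in>{x, y}. \<forall>b\<in>B. c * b \<in> zmod.span B"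
    using common_stable_lattice[of "{x, y}"] assms by auto
  then show ?thesis
    unfolding integral_el_def by (intro exI[of _ B]) (auto simp: mult.assoc intro: zspan_mult_closed)
qed

lemma integral_el_of_int [simp]: "integral_el (of_int n)"
  unfolding integral_el_def
  by (rule exI[of _ "{1}"]) (auto simp: zmod.span_singleton)

lemma integral_el_0 [simp]: "integral_el 0" and integral_el_1 [simp]: "integral_el 1"
  using integral_el_of_int[of 0] integral_el_of_int[of 1] by simp_all

lemma integral_el_uminus: "integral_el x \<Longrightarrow> integral_el (- x)"
  using integral_el_mult[of "of_int (-1)" x] integral_el_of_int[of "-1"] by simp

lemma integral_el_diff: "integral_el x \<Longrightarrow> integral_el y \<Longrightarrow> integral_el (x - y)"
  using integral_el_add[of x "- y"] integral_el_uminus by simp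

lemma integral_el_sum: "(\<And>i. i \<in> I \<Longrightarrow> integral_el (f i)) \<Longrightarrow> integral_el (sum f I)"
  by (induction I rule: infinite_finite_induct) (auto simp: integral_el_add)

lemma integral_el_prod: "(\<And>i. i \<in> I \<Longrightarrow> integral_el (f i)) \<Longrightarrow> integral_el (prod f I)"
  by (induction I rule: infinite_finite_induct) (auto simp: integral_el_mult)

lemma integral_el_power: "integral_el x \<Longrightarrow> integral_el (x ^ n)"
  by (induction n) (auto simp: integral_el_mult)

text \<open>Transitivity of integrality: if B is stable under all coefficients, the group generated
  by the \<open>z ^ j * b\<close> with j < n is stable under z, because the equation rewrites the
  overflow \<open>z ^ n * b\<close>.\<close>

lemma integral_el_monic_root:
  assumes "z ^ n = (\<Sum>j<n. c j * z ^ j)" "\<And>j. j < n \<Longrightarrow> integral_el (c j)" "n > 0"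
  shows "integral_el z"
proof -
  obtain B where B: "finite B" "1 \<in> zmod.span B" "\<forall>c\<in>c ` {..<n}. \<forall>b\<in>B. c * b \<in> zmod.span B"
    using common_stable_lattice[of "c ` {..<n}"] assms(2) by auto
  define P where "P = (\<lambda>(j, b). z ^ j * b) ` ({..<n} \<times> B)"
  have pow: "z ^ j * w \<in> zmod.span P" if "j < n" "w \<in> zmod.span B" for j w
    using that by (intro zspan_mult_closed[OF _ that(2)] zmod.span_base) (force simp: P_def)
  have "1 \<in> zmod.span P" using pow[of 0 1] B(2) assms(3) by simp
  moreover have "z * (z ^ j * b) \<in> zmod.span P" if "j < n" "b \<in> B" for j b
  proof (cases "Suc j < n")
    case True
    then show ?thesis using pow[of "Suc j" b] that by (simp add: zmod.span_base mult.assoc)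
  next
    case False
    then have "z * (z ^ j * b) = z ^ n * b" using that by (metis Suc_lessI mult.assoc power_Suc)
    also have "\<dots> = (\<Sum>j<n. z ^ j * (c j * b))"
      by (simp add: assms(1) sum_distrib_right sum_distrib_left mult_ac)
    also have "\<dots> \<in> zmod.span P" using B(3) that by (intro zmod.span_sum pow) auto
    finally show ?thesis .
  qed
  ultimately show ?thesis
    unfolding integral_el_def using B(1) by (intro exI[of _ P]) (auto simp: P_def)
qed

lemma integral_el_root:
  assumes "integral_el (z ^ n)" "n > 0"
  shows "integral_el z"
proof (rule integral_el_monic_root)
  show "z ^ n = (\<Sum>j<n. (if j = 0 then z ^ n else 0) * z ^ j)"
    using assms(2) by (simp add: if_distrib[of "\<lambda>x. x * _"] sum.delta cong: if_cong)
qed (use assms in auto)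

text \<open>A \<open>\<rat>\<close>-linear projection onto \<open>\<rat>\<close> maps a finitely generated group containing all powers
  of \<open>r\<close> into \<open>(1/d)\<int>\<close>.\<close>

lemma integral_el_rational:
  assumes "integral_el (of_rat r)"
  shows "r \<in> \<int>"
proof -
  obtain B where B: "finite B" "1 \<in> zmod.span B" "\<forall>b\<in>B. of_rat r * b \<in> zmod.span B"
    using assms integral_el_def by auto
  interpret qq: vector_space_pair "\<lambda>(q::rat) (z::complex). of_rat q * z" "(*) :: rat \<Rightarrow> rat \<Rightarrow> rat"
    by (unfold_locales) (auto simp: algebra_simps)
  have "qvec.independent {1}" by (simp add: qvec.dependent_single)
  from qq.linear_independent_extend[OF this, of "\<lambda>_. 1"]
  obtain \<phi> where lin: "Vector_Spaces.linear (\<lambda>(q::rat) (z::complex). of_rat q * z) (*) \<phi>" and \<phi>1: "\<phi> 1 = 1"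
    by auto
  have add: "\<phi> (x + y) = \<phi> x + \<phi> y" for x y
    using lin by (simp add: Vector_Spaces.linear_iff)
  have scale: "\<phi> (of_rat q * x) = q * \<phi> x" for q x
    using lin by (simp add: Vector_Spaces.linear_iff)
  have "\<exists>d::int. d > 0 \<and> (\<forall>b\<in>B. of_int d * \<phi> b \<in> \<int>)"
    using B(1)
  proof (induction B rule: finite_induct)
    case empty
    show ?case by (rule exI[of _ 1]) auto
  next
    case (insert b B)
    obtain d where d: "d > 0" "\<forall>b\<in>B. of_int d * \<phi> b \<in> \<int>" using insert by auto
    obtain p q where pq: "q > 0" "\<phi> b = of_int p / of_int q"
      using Rat_cases[of "\<phi> b"] Fract_of_int_quotient by metis
    have "of_int q * \<phi> b = of_int p" using pq by simp
    then have "of_int (d * q) * \<phi> b = of_int (d * p)" by simp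
    then have "of_int (d * q) * \<phi> b \<in> \<int>" using Ints_of_int by metis
    moreover have "of_int (d * q) * \<phi> b' \<in> \<int>" if "b' \<in> B" for b'
    proof -
      have "of_int (d * q) * \<phi> b' = of_int q * (of_int d * \<phi> b')" by simp
      then show ?thesis using d that by (metis Ints_mult Ints_of_int)
    qed
    ultimately show ?case using d(1) pq(1) by (intro exI[of _ "d * q"]) auto
  qed
  then obtain d :: int where d: "d > 0" "\<forall>b\<in>B. of_int d * \<phi> b \<in> \<int>" by blast
  have dspan: "of_int d * \<phi> w \<in> \<int>" if "w \<in> zmod.span B" for w
    using that
  proof (induction rule: zmod.span_induct_alt)
    case base
    show ?case using scale[of 0 0] by simp
  next
    case (step c b w)
    have "\<phi> (of_int c * b + w) = of_int c * \<phi> b + \<phi> w"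
      using add[of "of_rat (of_int c) * b" w] scale[of "of_int c" b] by simp
    then have "of_int d * \<phi> (of_int c * b + w) = of_int c * (of_int d * \<phi> b) + of_int d * \<phi> w"
      by (simp only: distrib_left mult.left_commute)
    moreover have "of_int c * (of_int d * \<phi> b) \<in> \<int>"
      using step(1) d(2) by (blast intro: Ints_mult[OF Ints_of_int])
    ultimately show ?case using step by (simp only: Ints_add)
  qed
  have powers: "of_rat r ^ n \<in> zmod.span B" for n
  proof (induction n)
    case (Suc n)
    then show ?case using zspan_mult_closed[of B "of_rat r" B] B(3) by simp
  qed (use B in simp)
  have dr: "of_int d * r ^ n \<in> \<int>" for n
    using dspan[OF powers[of n]] scale[of "r ^ n" 1] \<phi>1 by (simp add: of_rat_power)
  obtain p q where pq: "q > 0" "coprime p q" "r = of_int p / of_int q"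
    using Rat_cases[of r] Fract_of_int_quotient by metis
  \<comment> \<open>All powers of r share the denominator d, which leaves no room for a reduced
    denominator q of at least 2.\<close>
  have "q ^ n dvd d" for n
  proof -
    obtain k where "of_int d * r ^ n = of_int k" using dr[of n] by (auto elim: Ints_cases)
    then have "of_int d * (r ^ n * of_int q ^ n) = (of_int (k * q ^ n) :: rat)" by simp
    moreover have "r ^ n * of_int q ^ n = of_int p ^ n"
      using pq(1) by (simp add: pq(3) power_divide)
    ultimately have "of_int (d * p ^ n) = (of_int (k * q ^ n) :: rat)" by simp
    then have "q ^ n dvd d * p ^ n" by (metis dvd_triv_right of_int_eq_iff)
    then show ?thesis using pq(2) by (simp add: coprime_commute coprime_dvd_mult_left_iff)
  qed
  then have le: "q ^ n \<le> d" for n using d(1) zdvd_imp_le by blast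
  have "q = 1"
  proof (rule ccontr)
    assume "q \<noteq> 1"
    then have "q \<ge> 2" using pq(1) by simp
    then have "2 ^ nat d \<le> q ^ nat d" by (intro power_mono) auto
    moreover have "int (nat d) < 2 ^ nat d" using of_nat_less_two_power by blast
    ultimately show False using le[of "nat d"] d(1) by simp
  qed
  then show ?thesis using pq(3) by simp
qed

text \<open>Multiplying f(z) = 0 by the (n-1)-th power of the leading coefficient a gives a monic
  equation for a z.\<close>

lemma integral_el_lead_coeff_mult_root:
  fixes f :: "complex poly"
  assumes "\<And>i. integral_el (coeff f i)" "poly f z = 0" "degree f > 0"
  shows "integral_el (lead_coeff f * z)"
proof (rule integral_el_monic_root)
  define n a where "n = degree f" and "a = lead_coeff f"
  have "(\<Sum>i<n. coeff f i * z ^ i) + a * z ^ n = 0"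
    using assms(2) by (simp add: poly_altdef n_def a_def lessThan_Suc_atMost[symmetric])
  then have *: "a * z ^ n = (\<Sum>i<n. - (coeff f i * z ^ i))" by (simp add: sum_negf eq_neg_iff_add_eq_0 add.commute)
  have "a ^ n = a ^ (n - 1) * a"
    using assms(3) by (simp add: n_def flip: power_Suc2)
  then have "(a * z) ^ n = a ^ (n - 1) * (a * z ^ n)"
    by (simp add: power_mult_distrib)
  also have "\<dots> = (\<Sum>i<n. - (coeff f i * a ^ (n - 1 - i)) * (a * z) ^ i)"
    unfolding * sum_distrib_left
  proof (rule sum.cong)
    fix i assume "i \<in> {..<n}"
    then have "a ^ (n - 1) = a ^ (n - 1 - i) * a ^ i" by (simp flip: power_add)
    then show "a ^ (n - 1) * - (coeff f i * z ^ i) = - (coeff f i * a ^ (n - 1 - i)) * (a * z) ^ i"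
      by (simp add: power_mult_distrib)
  qed simp
  finally show "(lead_coeff f * z) ^ n = (\<Sum>i<n. - (coeff f i * a ^ (n - 1 - i)) * (lead_coeff f * z) ^ i)"
    by (simp add: a_def)
  show "integral_el (- (coeff f i * a ^ (n - 1 - i)))" for i
    using assms(1) by (simp add: a_def integral_el_uminus integral_el_mult integral_el_power)
qed (use assms in auto)

text \<open>A form of Gauss's lemma. With a the leading coefficient and n the degree of g, a is a
  coefficient of the product and a z is integral by \<open>integral_el_lead_coeff_mult_root\<close>;
  so removing a X^n from g keeps the product integral and lowers the degree.\<close>

lemma integral_coeffs_div_linear:
  fixes g :: "complex poly"
  assumes "\<And>i. integral_el (coeff ([:- z, 1:] * g) i)"
  shows "integral_el (coeff g i)"
  using assms
proof (induction "degree g" arbitrary: g i rule: less_induct)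
  case less
  define f where "f = [:- z, 1:] * g"
  show ?case
  proof (cases "g = 0")
    case False
    define n a where "n = degree g" and "a = lead_coeff g"
    have degf: "degree f = Suc n" "lead_coeff f = a"
      using False degree_mult_eq[of "[:- z, 1:]" g] lead_coeff_mult[of "[:- z, 1:]" g]
      by (simp_all add: f_def n_def a_def del: mult_pCons_left)
    have "integral_el a"
      using less.prems degf unfolding f_def by metis
    have "integral_el (a * z)"
      using integral_el_lead_coeff_mult_root[of f z] less.prems degf by (simp add: f_def)
    define g' where "g' = g - monom a n"
    have g': "[:- z, 1:] * g' = f - monom a (Suc n) + monom (a * z) n"
    proof -
      have "[:- z, 1:] * monom a n = monom a (Suc n) - monom (a * z) n"
        by (rule poly_eqI) (auto simp: coeff_pCons split: nat.splits)
      then show ?thesis by (simp add: g'_def f_def right_diff_distrib)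
    qed
    have int: "integral_el (coeff ([:- z, 1:] * g') i)" for i
      unfolding g' using less.prems[folded f_def] \<open>integral_el a\<close> \<open>integral_el (a * z)\<close>
      by (auto intro!: integral_el_add integral_el_diff)
    have "integral_el (coeff g' i)"
    proof (cases "g' = 0")
      case False
      have "degree g' \<le> n" by (simp add: g'_def n_def degree_diff_le degree_monom_le)
      moreover have "coeff g' n = 0" by (simp add: g'_def n_def a_def)
      ultimately have "degree g' < degree g"
        using False n_def by (metis eq_zero_or_degree_less)
      then show ?thesis using less.hyps int by blast
    qed auto
    then have "integral_el (coeff g' i + coeff (monom a n) i)"
      using \<open>integral_el a\<close> by (intro integral_el_add) auto
    then show ?thesis by (simp add: g'_def)
  qed simp
qed

text \<open>Dividing off the linear factors outside S keeps the coefficients integral, and the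
  constant coefficient of the rest is the product up to sign. This plays the part of the bound |a|_v
  \<Prod> max(1, |x_i|_v) \<le> 1 at the non-archimedean places v.\<close>

lemma integral_el_root_subset_prod:
  assumes "finite I" "\<And>n. integral_el (coeff (smult a (\<Prod>i\<in>I. [:- x i, 1:])) n)" "S \<subseteq> I"
  shows "integral_el (a * (\<Prod>i\<in>S. x i))"
proof -
  have "finite (I - S)" using assms(1) by simp
  then have "integral_el (coeff (smult a (\<Prod>i\<in>S. [:- x i, 1:])) n)" for n
    using assms(2,3)
  proof (induction "I - S" arbitrary: S n rule: finite_induct)
    case empty
    then have "S = I" by auto
    then show ?case using empty by simp
  next
    case (insert j A)
    have j: "j \<in> I" "j \<notin> S" using insert.hyps by auto
    have "A = I - insert j S" using insert.hyps by auto
    then have IH: "integral_el (coeff (smult a (\<Prod>i\<in>insert j S. [:- x i, 1:])) n)" for n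
      using insert.hyps(3)[of "insert j S"] insert.prems j by auto
    have "smult a (\<Prod>i\<in>insert j S. [:- x i, 1:]) = [:- x j, 1:] * smult a (\<Prod>i\<in>S. [:- x i, 1:])"
      using j finite_subset[OF insert.prems(2) assms(1)] by (simp add: mult_ac)
    then show ?case using integral_coeffs_div_linear IH by metis
  qed
  from this[of 0] have "integral_el (a * (\<Prod>i\<in>S. - x i))"
    by (simp add: poly_0_coeff_0[symmetric] poly_prod)
  moreover have "(\<Prod>i\<in>S. - x i) = (-1) ^ card S * (\<Prod>i\<in>S. x i)"
    using prod.distrib[of "\<lambda>_. -1" x S] by simp
  moreover have "(-1) ^ card S * (-1) ^ card S = (1::complex)"
    by (simp flip: power_mult_distrib)
  ultimately have "a * (\<Prod>i\<in>S. x i) = (of_int (-1)) ^ card S * (a * (\<Prod>i\<in>S. - x i))"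
    by (simp add: mult_ac)
  then show ?thesis
    using \<open>integral_el (a * (\<Prod>i\<in>S. - x i))\<close> integral_el_mult integral_el_power integral_el_of_int by metis
qed

text \<open>The exponents are cut into d layers: layer j contains one factor \<open>x i\<close> for
  each i with j < e i. Each layer is a product over a subset of the roots and uses up one factor
  a.\<close>

lemma integral_el_bounded_exponents:
  assumes "finite I" "\<And>n. integral_el (coeff (smult a (\<Prod>i\<in>I. [:- x i, 1:])) n)"
    and "\<And>i. i \<in> I \<Longrightarrow> e i \<le> d"
  shows "integral_el (a ^ d * (\<Prod>i\<in>I. x i ^ e i))"
proof -
  have pw: "x i ^ e i = (\<Prod>j<d. if j < e i then x i else 1)" if "i \<in> I" for i
  proof -
    have "{..<d} \<inter> {j. j < e i} = {..<e i}" using assms(3)[OF that] by auto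
    then show ?thesis by (simp add: prod.If_cases)
  qed
  have "(\<Prod>i\<in>I. x i ^ e i) = (\<Prod>i\<in>I. \<Prod>j<d. if j < e i then x i else 1)"
    using pw by (rule prod.cong[OF refl])
  also have "\<dots> = (\<Prod>j<d. \<Prod>i\<in>I. if j < e i then x i else 1)" by (rule prod.swap)
  also have "\<dots> = (\<Prod>j<d. \<Prod>i\<in>{i\<in>I. j < e i}. x i)"
    using assms(1) by (simp add: prod.inter_filter)
  finally have "a ^ d * (\<Prod>i\<in>I. x i ^ e i) = (\<Prod>j<d. a * (\<Prod>i\<in>{i\<in>I. j < e i}. x i))"
    by (simp add: prod.distrib)
  moreover have "integral_el (a * (\<Prod>i\<in>{i\<in>I. j < e i}. x i))" for j
    using integral_el_root_subset_prod[OF assms(1,2)] by auto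
  ultimately show ?thesis by (simp add: integral_el_prod)
qed

section \<open>Power sums\<close>

text \<open>The logarithmic derivative of the product, with \<alpha> / (1 - \<alpha> X) expanded as
  a geometric series.\<close>

lemma linear_factors_log_deriv:
  fixes \<alpha> :: "'i \<Rightarrow> complex"
  assumes "finite I"
  shows "fps_deriv (\<Prod>i\<in>I. 1 - fps_const (\<alpha> i) * fps_X) =
         - (\<Prod>i\<in>I. 1 - fps_const (\<alpha> i) * fps_X) * Abs_fps (\<lambda>n. \<Sum>i\<in>I. \<alpha> i ^ Suc n)"
  using assms
proof (induction I rule: finite_induct)
  case empty
  then show ?case by (simp add: fps_zero_def[symmetric])
next
  case (insert j I)
  define R where "R = (\<Prod>i\<in>I. 1 - fps_const (\<alpha> i) * fps_X)"
  define P where "P = Abs_fps (\<lambda>n. \<Sum>i\<in>I. \<alpha> i ^ Suc n)"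
  define G where "G = Abs_fps (\<lambda>n. \<alpha> j ^ Suc n)"
  define L where "L = 1 - fps_const (\<alpha> j) * fps_X"
  have LG: "L * G = fps_const (\<alpha> j)"
  proof (rule fps_ext)
    show "fps_nth (L * G) n = fps_nth (fps_const (\<alpha> j)) n" for n
      by (cases n) (simp_all add: L_def G_def left_diff_distrib mult.assoc)
  qed
  have "fps_deriv (L * R) = L * fps_deriv R + fps_deriv L * R" by simp
  also have "fps_deriv L = - (L * G)" unfolding LG by (simp add: L_def)
  also have "fps_deriv R = - R * P"
    using insert.IH by (simp add: R_def P_def)
  finally have "fps_deriv (L * R) = - (L * R) * (G + P)"
    by (simp add: algebra_simps)
  moreover have "Abs_fps (\<lambda>n. \<Sum>i\<in>insert j I. \<alpha> i ^ Suc n) = G + P"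
    using insert.hyps by (intro fps_ext) (simp add: G_def P_def)
  ultimately show ?case
    using insert.hyps by (simp add: L_def R_def)
qed

text \<open>\<open>reflect_poly\<close> turns X - \<alpha> into 1 - \<alpha> X; the identity then
  compares coefficients in \<open>linear_factors_log_deriv\<close>.\<close>

lemma newton_identity:
  fixes \<alpha> :: "'i \<Rightarrow> complex"
  assumes "finite I"
  defines "r \<equiv> \<lambda>n. coeff (reflect_poly (\<Prod>i\<in>I. [:- \<alpha> i, 1:])) n"
  shows "of_nat (Suc n) * r (Suc n) = - (\<Sum>i\<le>n. r i * (\<Sum>j\<in>I. \<alpha> j ^ Suc (n - i)))"
    and "r 0 = 1"
proof -
  define R where "R = (\<Prod>i\<in>I. 1 - fps_const (\<alpha> i) * fps_X)"
  have "reflect_poly [:- a, 1:] = [:1, - a:]" for a :: complex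
    by (rule poly_eqI) (auto simp: coeff_reflect_poly coeff_pCons split: nat.splits)
  moreover have "fps_of_poly [:1, - a:] = 1 - fps_const a * fps_X" for a :: complex
    by (simp add: fps_of_poly_pCons)
  ultimately have R: "R = fps_of_poly (reflect_poly (\<Prod>i\<in>I. [:- \<alpha> i, 1:]))"
    unfolding R_def reflect_poly_prod fps_of_poly_prod by (simp only:)
  have "fps_nth (fps_deriv R) n = fps_nth (- R * Abs_fps (\<lambda>n. \<Sum>i\<in>I. \<alpha> i ^ Suc n)) n"
    unfolding R_def by (subst linear_factors_log_deriv[OF assms(1)]) simp
  then show "of_nat (Suc n) * r (Suc n) = - (\<Sum>i\<le>n. r i * (\<Sum>j\<in>I. \<alpha> j ^ Suc (n - i)))"
    by (simp add: R r_def fps_mult_nth atMost_atLeast0 sum_negf del: of_nat_Suc power_Suc)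
  show "r 0 = 1"
    using R by (simp add: r_def lead_coeff_prod)
qed

text \<open>Together with its converse this replaces the fundamental theorem on symmetric
  polynomials: after a substitution w \<mapsto> u(w) the new power sums are linear combinations of
  the old ones, whereas the coefficients change in no simple way.\<close>

lemma rational_coeffs_imp_power_sums:
  fixes \<alpha> :: "'i \<Rightarrow> complex"
  assumes "finite I" "\<And>n. coeff (\<Prod>i\<in>I. [:- \<alpha> i, 1:]) n \<in> \<rat>"
  shows "(\<Sum>i\<in>I. \<alpha> i ^ n) \<in> \<rat>"
proof (induction n rule: less_induct)
  case (less n)
  define r where "r = (\<lambda>n. coeff (reflect_poly (\<Prod>i\<in>I. [:- \<alpha> i, 1:])) n)"
  have r: "r i \<in> \<rat>" for i
    using assms(2) by (simp add: r_def coeff_reflect_poly)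
  show ?case
  proof (cases n)
    case (Suc m)
    have "of_nat n * r n = - (\<Sum>i\<le>m. r i * (\<Sum>j\<in>I. \<alpha> j ^ Suc (m - i)))"
      using newton_identity(1)[OF assms(1), of m \<alpha>] Suc by (simp add: r_def del: of_nat_Suc power_Suc)
    also have "(\<Sum>i\<le>m. r i * (\<Sum>j\<in>I. \<alpha> j ^ Suc (m - i))) =
        r 0 * (\<Sum>j\<in>I. \<alpha> j ^ Suc m) + (\<Sum>i<m. r (Suc i) * (\<Sum>j\<in>I. \<alpha> j ^ Suc (m - Suc i)))"
      by (subst sum.atMost_shift) simp
    also have "r 0 = 1"
      using newton_identity(2)[OF assms(1), of \<alpha>] by (simp only: r_def)
    finally have *: "of_nat n * r n =
        - ((\<Sum>j\<in>I. \<alpha> j ^ n) + (\<Sum>i<m. r (Suc i) * (\<Sum>j\<in>I. \<alpha> j ^ Suc (m - Suc i))))"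
      by (simp only: mult_1_left Suc)
    have "(\<Sum>j\<in>I. \<alpha> j ^ n) =
        - (of_nat n * r n) - (\<Sum>i<m. r (Suc i) * (\<Sum>j\<in>I. \<alpha> j ^ Suc (m - Suc i)))"
      unfolding * by simp
    also have "\<dots> \<in> \<rat>"
      using r Suc
      by (intro Rats_diff Rats_minus_iff[THEN iffD2] Rats_sum[OF Rats_mult] less.IH)
        (auto intro: Rats_mult)
    finally show ?thesis .
  qed simp
qed

lemma power_sums_imp_rational_coeffs:
  fixes \<alpha> :: "'i \<Rightarrow> complex"
  assumes "finite I" "\<And>n. (\<Sum>i\<in>I. \<alpha> i ^ n) \<in> \<rat>"
  shows "coeff (\<Prod>i\<in>I. [:- \<alpha> i, 1:]) n \<in> \<rat>"
proof -
  define p where "p = (\<Prod>i\<in>I. [:- \<alpha> i, 1:])"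
  have r: "coeff (reflect_poly p) n \<in> \<rat>" for n
  proof (induction n rule: less_induct)
    case (less n)
    show ?case
    proof (cases n)
      case 0
      then show ?thesis using newton_identity(2)[OF assms(1), of \<alpha>] by (simp add: p_def)
    next
      case (Suc m)
      have "coeff (reflect_poly p) n =
          - (\<Sum>i\<le>m. coeff (reflect_poly p) i * (\<Sum>j\<in>I. \<alpha> j ^ Suc (m - i))) / of_nat n"
        unfolding Suc p_def newton_identity(1)[OF assms(1), of m \<alpha>, symmetric]
        by (simp del: of_nat_Suc)
      also have "\<dots> \<in> \<rat>"
        using less.IH assms(2) Suc
        by (intro Rats_divide Rats_minus_iff[THEN iffD2] Rats_sum[OF Rats_mult]) (auto simp del: power_Suc)
      finally show ?thesis .
    qed
  qed
  show ?thesis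
  proof (cases "n \<le> degree p")
    case True
    then have "coeff p n = coeff (reflect_poly p) (degree p - n)" by (simp add: coeff_reflect_poly)
    then show ?thesis using r by (simp add: p_def)
  next
    case False
    then show ?thesis by (simp add: p_def coeff_eq_0)
  qed
qed

section \<open>Conjugates and characteristic polynomials\<close>

text \<open>An element of Q(\<theta>) is carried by a rational polynomial u, and its conjugates are
  the values of the same u at the conjugates of \<theta>. This stands in for field
  embeddings.\<close>

definition ev :: "rat poly \<Rightarrow> complex \<Rightarrow> complex" where
  "ev u z = poly (map_poly of_rat u) z"

lemma ev_0 [simp]: "ev 0 z = 0" by (simp add: ev_def)

lemma ev_pCons [simp]: "ev (pCons a p) z = of_rat a + z * ev p z"
  by (simp add: ev_def map_poly_pCons)

lemma ev_1 [simp]: "ev 1 z = 1"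
  using ev_pCons[of 1 0 z] by (simp del: ev_pCons add: one_pCons)

lemma ev_add [simp]: "ev (p + q) z = ev p z + ev q z"
proof -
  have "map_poly of_rat (p + q) = (map_poly of_rat p + map_poly of_rat q :: complex poly)"
    by (rule poly_eqI) (simp add: coeff_map_poly of_rat_add)
  then show ?thesis by (simp add: ev_def)
qed

lemma ev_smult [simp]: "ev (smult c p) z = of_rat c * ev p z"
proof -
  have "map_poly of_rat (smult c p) = (smult (of_rat c) (map_poly of_rat p) :: complex poly)"
    by (rule poly_eqI) (simp add: coeff_map_poly of_rat_mult)
  then show ?thesis by (simp add: ev_def)
qed

lemma ev_mult [simp]: "ev (p * q) z = ev p z * ev q z"
  by (induction p) (simp_all add: algebra_simps)

lemma ev_uminus [simp]: "ev (- p) z = - ev p z"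
  using ev_smult[of "-1" p z] by (simp add: of_rat_minus)

lemma ev_diff [simp]: "ev (p - q) z = ev p z - ev q z"
  using ev_add[of p "- q" z] by simp

lemma ev_power [simp]: "ev (p ^ n) z = ev p z ^ n"
  by (induction n) auto

lemma ev_sum [simp]: "ev (sum f A) z = (\<Sum>a\<in>A. ev (f a) z)"
  by (induction A rule: infinite_finite_induct) auto

lemma ev_pcompose [simp]: "ev (pcompose p q) z = ev p (ev q z)"
  by (induction p) (simp_all add: pcompose_pCons)

lemma ev_of_int_poly: "ev (map_poly of_int f) z = poly (map_poly of_int f) z"
  by (induction f) (simp_all add: map_poly_pCons)

lemma ev_altdef: "ev u z = (\<Sum>i\<le>degree u. of_rat (coeff u i) * z ^ i)"
proof -
  have "degree (map_poly of_rat u :: complex poly) = degree u" by (simp add: degree_map_poly)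
  then show ?thesis by (simp add: ev_def poly_altdef coeff_map_poly)
qed

lemma rat_poly_scale_int:
  fixes u :: "rat poly"
  shows "\<exists>c f. c > 0 \<and> map_poly of_int f = smult (of_int c) u"
proof (induction u)
  case 0
  show ?case by (intro exI[of _ 1] exI[of _ 0]) auto
next
  case (pCons a u)
  then obtain c f where c: "c > 0" "map_poly of_int f = smult (of_int c) u" by auto
  obtain p q where pq: "q > 0" "a = of_int p / of_int q"
    using Rat_cases[of a] Fract_of_int_quotient by metis
  have "map_poly of_int (pCons (c * p) (smult q f)) = smult (of_int (c * q)) (pCons a u)"
  proof -
    have "map_poly of_int (smult q f) = (smult (of_int q) (map_poly of_int f) :: rat poly)"
      by (rule poly_eqI) (simp add: coeff_map_poly)
    then show ?thesis using c pq by (simp add: map_poly_pCons mult.commute)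
  qed
  then show ?case using c(1) pq(1) by (metis mult_pos_pos)
qed

lemma rat_coeffs_poly:
  fixes p :: "complex poly"
  assumes "\<And>n. coeff p n \<in> \<rat>"
  shows "\<exists>u. p = map_poly of_rat u"
  using assms
proof (induction p)
  case 0
  show ?case by (rule exI[of _ 0]) simp
next
  case (pCons a p)
  have "a \<in> \<rat>" using pCons.prems[of 0] by simp
  moreover have "coeff p n \<in> \<rat>" for n using pCons.prems[of "Suc n"] by simp
  ultimately obtain r u where "a = of_rat r" "p = map_poly of_rat u"
    using pCons.IH by (auto elim: Rats_cases)
  then show ?case by (intro exI[of _ "pCons r u"]) (simp add: map_poly_pCons)
qed

section \<open>Minimal polynomials and conjugates\<close>

lemma min_int_poly_is_min: "algebraic z \<Longrightarrow> is_min_int_poly z (min_int_poly z)"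
  unfolding min_int_poly_def by (rule theI'[OF is_min_int_poly_ex1])

lemma is_min_int_poly_nonzero: "is_min_int_poly z p \<Longrightarrow> p \<noteq> 0"
  by (auto simp: is_min_int_poly_def)

lemma is_min_int_poly_algebraic:
  assumes "is_min_int_poly z p"
  shows "algebraic z"
  using assms is_min_int_poly_nonzero[OF assms]
  by (intro algebraicI[of "map_poly of_int p"])
     (auto simp: is_min_int_poly_def coeff_map_poly map_poly_eq_0_iff)

lemma min_int_poly_unique: "is_min_int_poly z p \<Longrightarrow> min_int_poly z = p"
  using is_min_int_poly_ex1[OF is_min_int_poly_algebraic] min_int_poly_is_min[OF is_min_int_poly_algebraic]
  by metis

lemma irreducible_factor_with_root:
  fixes f :: "int poly" and z :: complex
  assumes "f \<noteq> 0" "poly (map_poly of_int f) z = 0"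
  shows "\<exists>q. irreducible q \<and> q dvd f \<and> poly (map_poly of_int q) z = 0"
  using assms
proof (induction f rule: prime_divisors_induct)
  case (unit x)
  then obtain c where c: "x = [:c:]" "c \<noteq> 0"
    by (metis is_unit_polyE not_is_unit_0)
  then show ?case using unit.prems(2) by (simp add: map_poly_pCons)
next
  case (factor p x)
  then consider "poly (map_poly of_int p) z = 0" | "poly (map_poly of_int x) z = 0"
    by (auto simp: map_poly_of_int_mult)
  then show ?case
  proof cases
    case 1
    then show ?thesis
      using prime_elem_imp_irreducible[OF prime_imp_prime_elem[OF factor.hyps(1)]]
      by (intro exI[of _ p]) simp
  next
    case 2
    with factor.IH factor.prems obtain q where
      "irreducible q" "q dvd x" "poly (map_poly of_int q) z = 0" by auto
    then show ?thesis by (intro exI[of _ q]) simp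
  qed
qed simp

text \<open>An irreducible factor of f that vanishes at z is the minimal polynomial up to sign, by
  the uniqueness of the latter.\<close>

lemma min_int_poly_dvd:
  assumes "poly (map_poly of_int f) z = 0" "algebraic z"
  shows "min_int_poly z dvd f"
proof (cases "f = 0")
  case False
  from irreducible_factor_with_root[OF this assms(1)]
  obtain q where q: "irreducible q" "q dvd f" "poly (map_poly of_int q) z = 0" by blast
  have q0: "q \<noteq> 0" using q(1) by auto
  have "lead_coeff (normalize q) > 0"
    using q0 linorder_less_linear[of "lead_coeff q" 0]
    by (auto simp: normalize_poly_eq_map_poly lead_coeff_map_poly_nz sgn_if)
  moreover have "poly (map_poly of_int (normalize q)) z = 0"
  proof -
    obtain k where "normalize q = q * k" by (metis dvd_normalize_iff dvd_refl dvdE)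
    then show ?thesis using q(3) by (simp add: map_poly_of_int_mult)
  qed
  ultimately have "is_min_int_poly z (normalize q)"
    using q(1) by (simp add: is_min_int_poly_def)
  then have "min_int_poly z = normalize q" by (rule min_int_poly_unique)
  then show ?thesis using q(2) by simp
qed simp

lemma min_int_poly_conjugate:
  assumes "algebraic z" "w \<in> conjugates z"
  shows "algebraic w" "min_int_poly w = min_int_poly z" "conjugates w = conjugates z"
proof -
  have *: "is_min_int_poly w (min_int_poly z)"
    using min_int_poly_is_min[OF assms(1)] assms(2) by (simp add: is_min_int_poly_def conjugates_def)
  show "algebraic w" by (rule is_min_int_poly_algebraic[OF *])
  show "min_int_poly w = min_int_poly z" by (rule min_int_poly_unique[OF *])
  then show "conjugates w = conjugates z" by (simp add: conjugates_def)
qed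

lemma self_in_conjugates: "algebraic z \<Longrightarrow> z \<in> conjugates z"
  using min_int_poly_is_min by (simp add: conjugates_def is_min_int_poly_def)

lemma degree_map_poly_of_int [simp]: "degree (map_poly of_int f :: 'a :: ring_char_0 poly) = degree f"
  by (rule degree_map_poly) auto

lemma degree_min_int_poly_pos:
  assumes "algebraic z"
  shows "degree (min_int_poly z) > 0"
proof (rule ccontr)
  assume "\<not> degree (min_int_poly z) > 0"
  then obtain c where c: "min_int_poly z = [:c:]" by (metis degree_eq_zeroE gr0I)
  show False
    using min_int_poly_is_min[OF assms] is_min_int_poly_nonzero[OF min_int_poly_is_min[OF assms]]
    by (auto simp: c is_min_int_poly_def map_poly_pCons)
qed

text \<open>A double root is a conjugate of z, so it has the same minimal polynomial m, and m would
  divide its own nonzero derivative.\<close>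

lemma rsquarefree_min_int_poly:
  assumes "algebraic z"
  shows "rsquarefree (map_poly of_int (min_int_poly z) :: complex poly)"
proof -
  define m where "m = min_int_poly z"
  define p :: "complex poly" where "p = map_poly of_int m"
  have "\<not> (poly p a = 0 \<and> poly (pderiv p) a = 0)" for a
  proof
    assume a: "poly p a = 0 \<and> poly (pderiv p) a = 0"
    then have "a \<in> conjugates z" by (simp add: conjugates_def p_def m_def)
    note conj = min_int_poly_conjugate[OF assms this]
    have "pderiv p = map_poly of_int (pderiv m)"
      by (rule poly_eqI) (simp add: p_def coeff_pderiv coeff_map_poly)
    then have "m dvd pderiv m"
      using min_int_poly_dvd[of "pderiv m" a] a conj by (simp add: m_def)
    moreover have "pderiv m \<noteq> 0" "degree (pderiv m) < degree m"
      using degree_min_int_poly_pos[OF assms] by (simp_all add: m_def pderiv_eq_0_iff degree_pderiv)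
    ultimately show False using dvd_imp_degree_le by fastforce
  qed
  then show ?thesis by (simp add: rsquarefree_roots p_def m_def)
qed

lemma min_int_poly_factorization:
  assumes "algebraic z"
  shows "finite (conjugates z)"
    and "map_poly of_int (min_int_poly z) =
      smult (of_int (lead_coeff (min_int_poly z))) (\<Prod>w\<in>conjugates z. [:- w, 1:])"
    and "card (conjugates z) = degree (min_int_poly z)"
proof -
  define m where "m = min_int_poly z"
  define p :: "complex poly" where "p = map_poly of_int m"
  have "m \<noteq> 0" using is_min_int_poly_nonzero[OF min_int_poly_is_min[OF assms]] by (simp add: m_def)
  then have "p \<noteq> 0" by (simp add: p_def map_poly_eq_0_iff)
  have "rsquarefree p" using rsquarefree_min_int_poly[OF assms] by (simp add: p_def m_def)
  from complex_poly_decompose_rsquarefree[OF this]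
  have dec: "smult (lead_coeff p) (\<Prod>w\<in>conjugates z. [:- w, 1:]) = p"
    by (simp add: conjugates_def p_def m_def)
  show fin: "finite (conjugates z)"
    using poly_roots_finite[OF \<open>p \<noteq> 0\<close>] by (simp add: conjugates_def p_def m_def)
  have lead: "lead_coeff p = of_int (lead_coeff m)" by (simp add: p_def coeff_map_poly)
  show "map_poly of_int (min_int_poly z) =
      smult (of_int (lead_coeff (min_int_poly z))) (\<Prod>w\<in>conjugates z. [:- w, 1:])"
    using dec lead by (simp add: p_def m_def)
  have "degree p = card (conjugates z)"
    by (subst dec[symmetric]) (use \<open>p \<noteq> 0\<close> in \<open>simp add: degree_prod_eq_sum_degree\<close>)
  then show "card (conjugates z) = degree (min_int_poly z)" by (simp add: p_def m_def)
qed

text \<open>Galois conjugation in the form used throughout: a polynomial relation over the rationals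
  passes from one conjugate to every other, since an integer multiple of it is divisible by the
  common minimal polynomial.\<close>

lemma ev_conjugate_eq_0:
  assumes "algebraic \<theta>" "w \<in> conjugates \<theta>" "w' \<in> conjugates \<theta>" "ev u w = 0"
  shows "ev u w' = 0"
proof -
  obtain c f where c: "c > 0" "map_poly of_int f = smult (of_int c) u"
    using rat_poly_scale_int by blast
  have *: "poly (map_poly of_int f) z = of_int c * ev u z" for z :: complex
    using ev_of_int_poly[of f z] by (simp add: c(2))
  have "min_int_poly \<theta> dvd f"
    using min_int_poly_dvd[of f w] * assms min_int_poly_conjugate[OF assms(1,2)] by simp
  then obtain g where "f = min_int_poly \<theta> * g" by (elim dvdE)
  then have "poly (map_poly of_int f) w' = 0"
    using assms(3) by (simp add: map_poly_of_int_mult conjugates_def)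
  then show ?thesis using * c(1) by simp
qed

section \<open>Traces, norms and characteristic polynomials\<close>

lemma conjugate_power_sums:
  assumes "algebraic \<theta>"
  shows "(\<Sum>w\<in>conjugates \<theta>. w ^ n) \<in> \<rat>"
proof (rule rational_coeffs_imp_power_sums)
  show "finite (conjugates \<theta>)" by (rule min_int_poly_factorization[OF assms])
  fix n
  define a m where "a = lead_coeff (min_int_poly \<theta>)" and "m = min_int_poly \<theta>"
  have "a > 0" using min_int_poly_is_min[OF assms] by (simp add: a_def is_min_int_poly_def)
  have "of_int (coeff m n) = of_int a * coeff (\<Prod>w\<in>conjugates \<theta>. [:- w, 1:]) n"
    using arg_cong[OF min_int_poly_factorization(2)[OF assms], of "\<lambda>p. coeff p n"]
    by (simp add: coeff_map_poly a_def m_def)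
  then have "coeff (\<Prod>w\<in>conjugates \<theta>. [:- w, 1:]) n = of_int (coeff m n) / of_int a"
    using \<open>a > 0\<close> by (simp add: field_simps)
  then show "coeff (\<Prod>w\<in>conjugates \<theta>. [:- w, 1:]) n \<in> \<rat>" by simp
qed

lemma conjugate_sum_rational:
  assumes "algebraic \<theta>"
  shows "(\<Sum>w\<in>conjugates \<theta>. ev u w) \<in> \<rat>"
proof -
  have "(\<Sum>w\<in>conjugates \<theta>. ev u w) =
      (\<Sum>i\<le>degree u. of_rat (coeff u i) * (\<Sum>w\<in>conjugates \<theta>. w ^ i))"
    unfolding ev_altdef sum_distrib_left by (rule sum.swap)
  also have "\<dots> \<in> \<rat>"
    using conjugate_power_sums[OF assms] by (intro Rats_sum[OF Rats_mult]) auto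
  finally show ?thesis .
qed

text \<open>The n-th power sum of the values of u is the sum of the values of \<open>u ^ n\<close>,
  hence rational, and Newton's identities turn power sums into coefficients.\<close>

lemma field_poly_rational:
  assumes "algebraic \<theta>"
  shows "coeff (\<Prod>w\<in>conjugates \<theta>. [:- ev u w, 1:]) n \<in> \<rat>"
proof (rule power_sums_imp_rational_coeffs)
  show "finite (conjugates \<theta>)" by (rule min_int_poly_factorization[OF assms])
  show "(\<Sum>w\<in>conjugates \<theta>. ev u w ^ n) \<in> \<rat>" for n
    using conjugate_sum_rational[OF assms, of "u ^ n"] by simp
qed

lemma norm_rational:
  assumes "algebraic \<theta>"
  shows "(\<Prod>w\<in>conjugates \<theta>. ev u w) \<in> \<rat>"
proof -
  have "(\<Prod>w\<in>conjugates \<theta>. ev u w) = coeff (\<Prod>w\<in>conjugates \<theta>. [:- ev (- u) w, 1:]) 0"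
    by (simp add: poly_0_coeff_0[symmetric] poly_prod)
  then show ?thesis using field_poly_rational[OF assms] by metis
qed

lemma algebraic_ev:
  assumes "algebraic \<theta>"
  shows "algebraic (ev u \<theta>)"
proof (rule algebraicI')
  let ?C = "\<Prod>w\<in>conjugates \<theta>. [:- ev u w, 1:]"
  show "coeff ?C n \<in> \<rat>" for n by (rule field_poly_rational[OF assms])
  have fin: "finite (conjugates \<theta>)" by (rule min_int_poly_factorization[OF assms])
  then show "?C \<noteq> 0" by simp
  show "poly ?C (ev u \<theta>) = 0"
    using fin self_in_conjugates[OF assms] by (auto simp: poly_prod prod_zero_iff)
qed

text \<open>Scaled to an integer polynomial, the product is \<open>m ^ e * g\<close> with m not
  dividing g. A root of g would be some \<open>ev u w\<close>, hence a conjugate of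
  \<open>ev u \<theta>\<close>, and then m would divide g after all; so g is constant.\<close>

lemma field_poly_power:
  assumes "algebraic \<theta>"
  shows "\<exists>e. (\<Prod>w\<in>conjugates \<theta>. [:- ev u w, 1:]) = (\<Prod>v\<in>conjugates (ev u \<theta>). [:- v, 1:]) ^ e"
proof -
  define C where "C = (\<Prod>w\<in>conjugates \<theta>. [:- ev u w, 1:])"
  define \<alpha> where "\<alpha> = ev u \<theta>"
  define m where "m = min_int_poly \<alpha>"
  note fin = min_int_poly_factorization(1)[OF assms]
  have alg: "algebraic \<alpha>" using algebraic_ev[OF assms] by (simp add: \<alpha>_def)
  note m = min_int_poly_is_min[OF alg, folded m_def]
  have m0: "m \<noteq> 0" using is_min_int_poly_nonzero[OF m] .
  obtain r where r: "C = map_poly of_rat r"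
    using rat_coeffs_poly[of C] field_poly_rational[OF assms] by (auto simp: C_def)
  obtain c f where c: "c > 0" "map_poly of_int f = smult (of_int c) r"
    using rat_poly_scale_int by blast
  have f: "map_poly of_int f = smult (of_int c) C"
  proof (rule poly_eqI)
    fix n
    have "of_int (coeff f n) = of_int c * coeff r n"
      using arg_cong[OF c(2), of "\<lambda>p. coeff p n"] by (simp add: coeff_map_poly)
    then have "(of_rat (of_int (coeff f n)) :: complex) = of_rat (of_int c * coeff r n)" by simp
    then show "coeff (map_poly of_int f) n = coeff (smult (of_int c) C) n"
      by (simp add: r coeff_map_poly of_rat_mult)
  qed
  have "C \<noteq> 0" using fin by (simp add: C_def)
  then have "f \<noteq> 0" using f c(1) by auto
  have "\<not> is_unit m" using m irreducible_not_unit by (auto simp: is_min_int_poly_def)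
  obtain g where g: "f = m ^ multiplicity m f * g" "\<not> m dvd g"
    using multiplicity_decompose'[OF \<open>f \<noteq> 0\<close> \<open>\<not> is_unit m\<close>] by (auto simp: m0)
  define e where "e = multiplicity m f"
  have "degree g = 0"
  proof (rule ccontr)
    assume "degree g \<noteq> 0"
    then have "\<not> constant (poly (map_poly of_int g :: complex poly))"
      by (simp add: constant_degree)
    then obtain v where v: "poly (map_poly of_int g) v = (0 :: complex)"
      using fundamental_theorem_of_algebra by blast
    then have "poly (map_poly of_int f) v = (0 :: complex)"
      by (subst g(1)) (simp add: map_poly_of_int_mult)
    then have "poly C v = 0" using f c(1) by simp
    then obtain w where w: "w \<in> conjugates \<theta>" "v = ev u w"
      using fin by (auto simp: C_def poly_prod prod_zero_iff)
    have "ev (pcompose (map_poly of_int m) u) \<theta> = 0"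
      using m by (simp add: ev_of_int_poly is_min_int_poly_def \<alpha>_def)
    then have "ev (pcompose (map_poly of_int m) u) w = 0"
      using ev_conjugate_eq_0[OF assms self_in_conjugates[OF assms] w(1)] by blast
    then have "v \<in> conjugates \<alpha>"
      using w(2) by (simp add: ev_of_int_poly conjugates_def m_def)
    then have "m dvd g"
      using min_int_poly_dvd[OF v] min_int_poly_conjugate[OF alg] by (simp add: m_def)
    then show False using g(2) by blast
  qed
  then obtain g0 where g0: "g = [:g0:]" by (metis degree_eq_zeroE)
  define a where "a = lead_coeff m"
  define M where "M = (\<Prod>v\<in>conjugates \<alpha>. [:- v, 1:])"
  have "map_poly of_int (m ^ e) = (map_poly of_int m ^ e :: complex poly)" for e
    by (induction e) (simp_all add: map_poly_of_int_mult)
  moreover have "map_poly of_int (smult g0 q) = (smult (of_int g0) (map_poly of_int q) :: complex poly)" for q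
    by (rule poly_eqI) (simp add: coeff_map_poly)
  moreover have "f = smult g0 (m ^ e)" using g(1) by (simp add: g0 e_def)
  ultimately have "map_poly of_int f = smult (of_int (a ^ e * g0)) (M ^ e)"
    using min_int_poly_factorization(2)[OF alg]
    by (simp add: M_def a_def m_def smult_power mult.commute)
  then have eq: "smult (of_int c) C = smult (of_int (a ^ e * g0)) (M ^ e)" using f by simp
  have "lead_coeff C = 1" "lead_coeff (M ^ e) = 1"
    by (simp_all add: C_def M_def lead_coeff_prod lead_coeff_power)
  then have "(of_int c :: complex) = of_int (a ^ e * g0)"
    using arg_cong[OF eq, of lead_coeff] by (simp only: lead_coeff_smult mult_1_right)
  then have "C = M ^ e"
    using eq c(1) by (metis of_int_eq_0_iff order_less_irrefl smult_cancel)
  then show ?thesis by (auto simp: C_def M_def \<alpha>_def)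
qed

text \<open>In terms of multisets of roots, the e-th power is an e-fold repetition.\<close>

lemma sum_conjugates_field:
  assumes "algebraic \<theta>"
    and "(\<Prod>w\<in>conjugates \<theta>. [:- ev u w, 1:]) = (\<Prod>v\<in>conjugates (ev u \<theta>). [:- v, 1:]) ^ e"
  shows "(\<Sum>w\<in>conjugates \<theta>. \<phi> (ev u w)) = real e * (\<Sum>v\<in>conjugates (ev u \<theta>). \<phi> v)"
proof -
  have pr: "proots (\<Prod>w\<in>A. [:- g w, 1:]) = (\<Sum>w\<in>A. {#g w#})" for A and g :: "complex \<Rightarrow> complex"
    by (subst proots_prod) auto
  have sm: "sum_mset (image_mset \<phi> (\<Sum>w\<in>A. {#g w#})) = (\<Sum>w\<in>A. \<phi> (g w))"
    for A and g :: "complex \<Rightarrow> complex"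
    by (induction A rule: infinite_finite_induct) auto
  have rp: "sum_mset (image_mset \<phi> (repeat_mset e X)) = real e * sum_mset (image_mset \<phi> X)" for X
    by (induction e) (auto simp: algebra_simps)
  have "(\<Sum>w\<in>conjugates \<theta>. {#ev u w#}) = repeat_mset e (\<Sum>v\<in>conjugates (ev u \<theta>). {#v#})"
    using arg_cong[OF assms(2), of proots] pr[of "\<lambda>v. v"] by (simp add: pr proots_power)
  from arg_cong[OF this, of "\<lambda>X. sum_mset (image_mset \<phi> X)"] show ?thesis
    using sm[of "\<lambda>v. v"] by (simp add: sm rp)
qed

lemma content_min_int_poly:
  assumes "algebraic z"
  shows "content (min_int_poly z) = 1"
proof -
  define m where "m = min_int_poly z"
  have "irreducible m" using min_int_poly_is_min[OF assms] by (simp add: is_min_int_poly_def m_def)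
  moreover have "m = [:content m:] * primitive_part m" by simp
  ultimately have "is_unit [:content m:] \<or> is_unit (primitive_part m)"
    using irreducibleD by blast
  moreover have "\<not> is_unit (primitive_part m)"
  proof
    assume "is_unit (primitive_part m)"
    then have "degree (primitive_part m) = 0" by (metis is_unit_polyE degree_pCons_0)
    then show False using degree_min_int_poly_pos[OF assms] by (simp add: m_def)
  qed
  ultimately have "is_unit (content m)" by (simp add: is_unit_const_poly_iff)
  then show ?thesis by (metis is_unit_normalize normalize_content m_def)
qed

text \<open>The height of an element of \<open>\<rat>(\<theta>)\<close> read off its characteristic polynomial instead of its
  minimal polynomial.\<close>

lemma field_height:
  assumes "algebraic \<theta>"
  obtains P :: "int poly" where "content P = 1" "lead_coeff P > 0"
    "map_poly of_int P = smult (of_int (lead_coeff P)) (\<Prod>w\<in>conjugates \<theta>. [:- ev u w, 1:])"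
    "real (card (conjugates \<theta>)) * weil_height (ev u \<theta>) =
       ln (real_of_int (lead_coeff P)) + (\<Sum>w\<in>conjugates \<theta>. ln (max 1 (cmod (ev u w))))"
proof -
  obtain e where e: "(\<Prod>w\<in>conjugates \<theta>. [:- ev u w, 1:]) = (\<Prod>v\<in>conjugates (ev u \<theta>). [:- v, 1:]) ^ e"
    using field_poly_power[OF assms] by blast
  define \<alpha> where "\<alpha> = ev u \<theta>"
  have alg: "algebraic \<alpha>" using algebraic_ev[OF assms] by (simp add: \<alpha>_def)
  define m where "m = min_int_poly \<alpha>"
  have lead: "lead_coeff m > 0"
    using min_int_poly_is_min[OF alg] by (simp add: is_min_int_poly_def m_def)
  have "map_poly of_int (m ^ e) = (map_poly of_int m ^ e :: complex poly)" for e
    by (induction e) (simp_all add: map_poly_of_int_mult)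
  then have fac: "map_poly of_int (m ^ e) = smult (of_int (lead_coeff (m ^ e)))
      (\<Prod>w\<in>conjugates \<theta>. [:- ev u w, 1:])"
    using min_int_poly_factorization(2)[OF alg]
    by (simp add: e m_def \<alpha>_def smult_power lead_coeff_power)
  \<comment> \<open>By Gauss's lemma powers of the primitive m stay primitive, so
    \<open>m ^ e\<close> is the required P.\<close>
  have cont: "content (m ^ e) = 1" for e
    by (induction e) (simp_all add: content_mult content_min_int_poly[OF alg] m_def)
  have card: "card (conjugates \<theta>) = e * degree m"
  proof -
    have "real (card (conjugates \<theta>)) = real e * real (card (conjugates \<alpha>))"
      using sum_conjugates_field[OF assms e, of "\<lambda>_. 1"] by (simp add: \<alpha>_def)
    then show ?thesis
      using min_int_poly_factorization(3)[OF alg] by (simp add: m_def flip: of_nat_mult)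
  qed
  have "real (card (conjugates \<theta>)) * weil_height \<alpha> =
      real e * (ln (real_of_int (lead_coeff m)) + (\<Sum>w\<in>conjugates \<alpha>. ln (max 1 (cmod w))))"
    using degree_min_int_poly_pos[OF alg] by (simp add: card weil_height_def m_def)
  also have "\<dots> = ln (real_of_int (lead_coeff (m ^ e))) + (\<Sum>w\<in>conjugates \<theta>. ln (max 1 (cmod (ev u w))))"
    using sum_conjugates_field[OF assms e, of "\<lambda>v. ln (max 1 (cmod v))"] lead
    by (simp add: \<alpha>_def lead_coeff_power ln_realpow distrib_left)
  finally show ?thesis
    using that[of "m ^ e"] cont fac lead by (simp add: \<alpha>_def lead_coeff_power)
qed

section \<open>Primitive elements\<close>

definition adjoin :: "complex \<Rightarrow> complex set" where
  "adjoin \<theta> = range (\<lambda>u. ev u \<theta>)"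

lemma adjoin_generator: "\<theta> \<in> adjoin \<theta>"
  unfolding adjoin_def by (rule range_eqI[of _ _ "[:0, 1:]"]) simp

lemma adjoin_of_rat: "of_rat r \<in> adjoin \<theta>"
  unfolding adjoin_def by (rule range_eqI[of _ _ "[:r:]"]) simp

lemma adjoin_add: "x \<in> adjoin \<theta> \<Longrightarrow> y \<in> adjoin \<theta> \<Longrightarrow> x + y \<in> adjoin \<theta>"
  unfolding adjoin_def by (auto simp flip: ev_add)

lemma adjoin_mult: "x \<in> adjoin \<theta> \<Longrightarrow> y \<in> adjoin \<theta> \<Longrightarrow> x * y \<in> adjoin \<theta>"
  unfolding adjoin_def by (auto simp flip: ev_mult)

lemma adjoin_uminus: "x \<in> adjoin \<theta> \<Longrightarrow> - x \<in> adjoin \<theta>"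
  unfolding adjoin_def by (auto simp flip: ev_uminus)

lemma adjoin_diff: "x \<in> adjoin \<theta> \<Longrightarrow> y \<in> adjoin \<theta> \<Longrightarrow> x - y \<in> adjoin \<theta>"
  using adjoin_add[of x \<theta> "- y"] adjoin_uminus by simp

lemma adjoin_0: "0 \<in> adjoin \<theta>"
  using adjoin_of_rat[of 0] by simp

lemma adjoin_of_int: "of_int r \<in> adjoin \<theta>"
  using adjoin_of_rat[of "of_int r"] by simp

text \<open>The minimal polynomial of z is c + X m', where c is nonzero because m' has smaller
  degree and cannot vanish at z; hence 1/z = - m'(z) / c.\<close>

lemma adjoin_inverse:
  assumes "algebraic \<theta>" "z \<in> adjoin \<theta>"
  shows "inverse z \<in> adjoin \<theta>"
proof (cases "z = 0")
  case False
  obtain u where u: "z = ev u \<theta>" using assms(2) by (auto simp: adjoin_def)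
  have alg: "algebraic z" using algebraic_ev[OF assms(1)] u by simp
  define m where "m = min_int_poly z"
  have deg: "degree m > 0" using degree_min_int_poly_pos[OF alg] by (simp add: m_def)
  obtain c m' where m: "m = pCons c m'" by (rule pCons_cases)
  have root: "of_int c + z * poly (map_poly of_int m') z = 0"
    using min_int_poly_is_min[OF alg, folded m_def] by (simp add: is_min_int_poly_def m map_poly_pCons)
  have "c \<noteq> 0"
  proof
    assume "c = 0"
    then have "m dvd m'" using root False min_int_poly_dvd[OF _ alg] by (simp add: m_def)
    moreover have "m' \<noteq> 0" using deg by (auto simp: m)
    ultimately show False using dvd_imp_degree_le[of m m'] by (simp add: m)
  qed
  have "inverse z = of_rat (- 1 / of_int c) * ev (map_poly of_int m') z"
    using root \<open>c \<noteq> 0\<close> False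
    by (simp add: ev_of_int_poly of_rat_divide of_rat_minus field_simps eq_neg_iff_add_eq_0)
  also have "ev (map_poly of_int m') z \<in> adjoin \<theta>"
    unfolding adjoin_def by (rule range_eqI[of _ _ "pcompose (map_poly of_int m') u"]) (simp add: u)
  then have "of_rat (- 1 / of_int c) * ev (map_poly of_int m') z \<in> adjoin \<theta>"
    by (intro adjoin_mult adjoin_of_rat)
  finally show ?thesis .
qed (simp add: adjoin_0)

lemma adjoin_pcompose_coeff:
  assumes "\<And>n. coeff p n \<in> adjoin \<theta>" "a \<in> adjoin \<theta>" "b \<in> adjoin \<theta>"
  shows "coeff (pcompose p [:a, b:]) n \<in> adjoin \<theta>"
  using assms(1)
proof (induction p arbitrary: n)
  case (pCons c p)
  have "c \<in> adjoin \<theta>" using pCons.prems[of 0] by simp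
  define q where "q = pcompose p [:a, b:]"
  have "coeff p n \<in> adjoin \<theta>" for n using pCons.prems[of "Suc n"] by simp
  then have "coeff q n \<in> adjoin \<theta>" for n unfolding q_def by (rule pCons.IH)
  moreover have "pcompose (pCons c p) [:a, b:] = [:c:] + (smult a q + pCons 0 (smult b q))"
    by (simp add: pcompose_pCons q_def)
  ultimately show ?case using \<open>c \<in> adjoin \<theta>\<close> assms(2,3)
    by (cases n) (auto intro!: adjoin_add adjoin_mult simp: adjoin_0)
qed (simp add: adjoin_0)

text \<open>The witness has the roots a + c b for all pairs of conjugates; the binomial theorem
  expresses its power sums through those of the two sets of conjugates.\<close>

lemma algebraic_add_scaled:
  fixes \<alpha> \<beta> :: complex
  assumes "algebraic \<alpha>" "algebraic \<beta>"
  shows "algebraic (\<alpha> + of_nat c * \<beta>)"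
proof (rule algebraicI')
  define I where "I = conjugates \<alpha> \<times> conjugates \<beta>"
  define f where "f = (\<lambda>(a, b). a + of_nat c * b :: complex)"
  have fin: "finite I"
    using min_int_poly_factorization(1) assms by (simp add: I_def)
  show "coeff (\<Prod>i\<in>I. [:- f i, 1:]) n \<in> \<rat>" for n
  proof (rule power_sums_imp_rational_coeffs[OF fin])
    fix n
    have "(\<Sum>i\<in>I. f i ^ n) = (\<Sum>i\<in>I. \<Sum>k\<le>n. of_nat (n choose k) * fst i ^ k * (of_nat c * snd i) ^ (n - k))"
      by (simp add: f_def case_prod_beta binomial_ring)
    also have "\<dots> = (\<Sum>k\<le>n. \<Sum>i\<in>I. of_nat (n choose k) * fst i ^ k * (of_nat c * snd i) ^ (n - k))"
      by (rule sum.swap)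
    also have "\<dots> = (\<Sum>k\<le>n. of_nat (n choose k) * of_nat c ^ (n - k) *
        ((\<Sum>a\<in>conjugates \<alpha>. a ^ k) * (\<Sum>b\<in>conjugates \<beta>. b ^ (n - k))))"
    proof (rule sum.cong)
      fix k
      have "(\<Sum>a\<in>conjugates \<alpha>. a ^ k) * (\<Sum>b\<in>conjugates \<beta>. b ^ (n - k)) =
          (\<Sum>i\<in>I. fst i ^ k * snd i ^ (n - k))"
        by (simp add: I_def sum_product sum.cartesian_product case_prod_beta)
      then show "(\<Sum>i\<in>I. of_nat (n choose k) * fst i ^ k * (of_nat c * snd i) ^ (n - k)) =
          of_nat (n choose k) * of_nat c ^ (n - k) *
          ((\<Sum>a\<in>conjugates \<alpha>. a ^ k) * (\<Sum>b\<in>conjugates \<beta>. b ^ (n - k)))"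
        by (simp add: sum_distrib_left power_mult_distrib mult_ac)
    qed simp
    also have "\<dots> \<in> \<rat>"
      using conjugate_power_sums assms by (intro Rats_sum[OF Rats_mult] Rats_mult) auto
    finally show "(\<Sum>i\<in>I. f i ^ n) \<in> \<rat>" .
  qed
  show "(\<Prod>i\<in>I. [:- f i, 1:]) \<noteq> 0" using fin by simp
  have "(\<alpha>, \<beta>) \<in> I" using self_in_conjugates assms by (simp add: I_def)
  then show "poly (\<Prod>i\<in>I. [:- f i, 1:]) (\<alpha> + of_nat c * \<beta>) = 0"
    using fin by (auto simp: poly_prod prod_zero_iff f_def intro!: bexI[of _ "(\<alpha>, \<beta>)"])
qed

text \<open>Over \<open>\<rat>(\<theta>)\<close> with \<open>\<theta> = \<alpha> + c \<beta>\<close>, the minimal polynomial of \<open>\<beta>\<close> divides both that of \<open>\<beta>\<close> over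
  \<open>\<rat>\<close> and \<open>m(\<theta> - c X)\<close> for the minimal polynomial \<open>m\<close> of \<open>\<alpha>\<close>; for all but finitely many \<open>c\<close> the
  only common root is \<open>\<beta>\<close>, and it is simple.\<close>

lemma primitive_element:
  fixes \<alpha> \<beta> :: complex
  assumes "algebraic \<alpha>" "algebraic \<beta>"
  shows "\<exists>\<theta>. algebraic \<theta> \<and> \<alpha> \<in> adjoin \<theta> \<and> \<beta> \<in> adjoin \<theta>"
proof -
  have "finite ((\<lambda>(a, b). (a - \<alpha>) / (\<beta> - b)) ` (conjugates \<alpha> \<times> conjugates \<beta>))" (is "finite ?B")
    using min_int_poly_factorization(1) assms by simp
  moreover have "infinite (range (of_nat :: nat \<Rightarrow> complex))"
    by (simp add: finite_image_iff inj_on_def)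
  ultimately obtain c :: nat where c: "of_nat c \<notin> ?B"
    by (metis (no_types, lifting) finite_subset image_subset_iff)
  define \<theta> where "\<theta> = \<alpha> + of_nat c * \<beta>"
  have alg: "algebraic \<theta>" using algebraic_add_scaled assms by (simp add: \<theta>_def)
  have unique: "b = \<beta>" if "a \<in> conjugates \<alpha>" "b \<in> conjugates \<beta>" "a + of_nat c * b = \<theta>" for a b
  proof (rule ccontr)
    assume "b \<noteq> \<beta>"
    then have "of_nat c = (a - \<alpha>) / (\<beta> - b)"
      using that(3) by (simp add: \<theta>_def field_simps)
    then show False using c that by force
  qed
  \<comment> \<open>S is the ideal of polynomials over Q(\<theta>) that vanish at \<beta>; its
    nonzero element \<mu> of least degree serves as the minimal polynomial of \<beta> over
    Q(\<theta>).\<close>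
  define S where "S = {p :: complex poly. (\<forall>n. coeff p n \<in> adjoin \<theta>) \<and> poly p \<beta> = 0}"
  define f2 :: "complex poly" where "f2 = map_poly of_int (min_int_poly \<beta>)"
  define f1 :: "complex poly" where "f1 = pcompose (map_poly of_int (min_int_poly \<alpha>)) [:\<theta>, - of_nat c:]"
  have "f2 \<noteq> 0" using is_min_int_poly_nonzero[OF min_int_poly_is_min[OF assms(2)]]
    by (simp add: f2_def map_poly_eq_0_iff)
  have f2S: "f2 \<in> S"
    using min_int_poly_is_min[OF assms(2)]
    by (simp add: S_def f2_def coeff_map_poly adjoin_of_int is_min_int_poly_def)
  have f1S: "f1 \<in> S"
  proof -
    have "coeff f1 n \<in> adjoin \<theta>" for n
      unfolding f1_def using adjoin_of_int[of "- int c"]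
      by (intro adjoin_pcompose_coeff) (auto simp: coeff_map_poly adjoin_of_int adjoin_generator)
    moreover have "poly f1 \<beta> = 0"
      using min_int_poly_is_min[OF assms(1)] by (simp add: f1_def poly_pcompose is_min_int_poly_def \<theta>_def)
    ultimately show ?thesis by (simp add: S_def)
  qed
  obtain \<mu> where \<mu>: "\<mu> \<noteq> 0" "\<mu> \<in> S" and least: "\<And>f. f \<noteq> 0 \<Longrightarrow> f \<in> S \<Longrightarrow> degree \<mu> \<le> degree f"
    using ex_has_least_nat[of "\<lambda>p. p \<noteq> 0 \<and> p \<in> S" f2 degree] \<open>f2 \<noteq> 0\<close> f2S by blast
  \<comment> \<open>Division by cancelling leading terms. The multiplier k lies in
    \<open>adjoin \<theta>\<close> because that set is closed under inverses, so the difference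
    stays in S.\<close>
  have dvd: "\<mu> dvd f" if "f \<in> S" for f
    using that
  proof (induction "degree f" arbitrary: f rule: less_induct)
    case less
    show ?case
    proof (cases "f = 0")
      case False
      define k where "k = lead_coeff f * inverse (lead_coeff \<mu>)"
      define g where "g = monom k (degree f - degree \<mu>) * \<mu>"
      have "degree \<mu> \<le> degree f" using least False less.prems by blast
      moreover have "k \<noteq> 0" using False \<mu>(1) by (simp add: k_def)
      ultimately have deg: "degree g = degree f"
        using \<mu>(1) by (simp add: g_def degree_mult_eq degree_monom_eq)
      have lead: "lead_coeff g = lead_coeff f"
        unfolding g_def lead_coeff_mult lead_coeff_monom k_def using \<mu>(1) by simp
      have "k \<in> adjoin \<theta>"
        using less.prems \<mu>(2) adjoin_inverse[OF alg] by (auto simp: k_def S_def intro!: adjoin_mult)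
      then have "coeff g n \<in> adjoin \<theta>" for n
        using \<mu>(2) by (auto simp: g_def coeff_monom_mult S_def adjoin_0 intro!: adjoin_mult)
      then have gS: "f - g \<in> S"
        using less.prems \<mu>(2) by (auto simp: S_def g_def intro!: adjoin_diff)
      have "\<mu> dvd f - g"
      proof (cases "f - g = 0")
        case False
        have "coeff (f - g) (degree f) = 0" using deg lead by simp
        moreover have "degree (f - g) \<le> degree f" using deg by (simp add: degree_diff_le)
        ultimately have "degree (f - g) < degree f"
          using False by (metis eq_zero_or_degree_less)
        then show ?thesis using less.hyps gS by blast
      qed auto
      then have "\<mu> dvd (f - g) + g" by (intro dvd_add) (simp_all add: g_def)
      then show ?thesis by simp
    qed simp
  qed
  have zero: "poly f b = 0" if "poly \<mu> b = 0" "f \<in> S" for f b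
    using dvd[OF that(2)] that(1) by (metis dvdE mult_zero_left poly_mult)
  have root: "b = \<beta>" if b: "poly \<mu> b = 0" for b
  proof (rule unique)
    show "\<theta> - of_nat c * b \<in> conjugates \<alpha>"
      using zero[OF b f1S] by (simp add: f1_def poly_pcompose conjugates_def mult.commute)
    show "b \<in> conjugates \<beta>"
      using zero[OF b f2S] by (simp add: f2_def conjugates_def)
  qed simp
  have "[:- \<beta>, 1:] dvd \<mu>" using \<mu>(2) by (simp add: S_def poly_eq_0_iff_dvd)
  then obtain \<nu> where \<nu>: "\<mu> = [:- \<beta>, 1:] * \<nu>" by (elim dvdE)
  \<comment> \<open>A further root of \<mu> is again \<beta>, which would make \<beta> a double root
    of its minimal polynomial over the rationals.\<close>
  have "degree \<nu> = 0"
  proof (rule ccontr)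
    assume "degree \<nu> \<noteq> 0"
    then have "\<not> constant (poly \<nu>)" by (simp add: constant_degree)
    then obtain b where "poly \<nu> b = 0" using fundamental_theorem_of_algebra by blast
    moreover from this have "b = \<beta>" using root \<nu> by simp
    ultimately have "[:- \<beta>, 1:] dvd \<nu>" by (simp add: poly_eq_0_iff_dvd)
    then have "[:- \<beta>, 1:] * [:- \<beta>, 1:] dvd \<mu>" unfolding \<nu> by (rule mult_dvd_mono[OF dvd_refl])
    then have "[:- \<beta>, 1:] * [:- \<beta>, 1:] dvd f2" by (rule dvd_trans[OF _ dvd[OF f2S]])
    then have "[:- \<beta>, 1:] ^ 2 dvd f2" by (simp only: power2_eq_square)
    then have "2 \<le> order \<beta> f2" using \<open>f2 \<noteq> 0\<close> by (simp add: order_divides)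
    then show False
      using rsquarefree_min_int_poly[OF assms(2)] by (auto simp: rsquarefree_def f2_def dest!: spec[of _ \<beta>])
  qed
  then obtain k where k: "\<nu> = [:k:]" by (metis degree_eq_zeroE)
  have "k \<noteq> 0" using \<nu> k \<mu>(1) by auto
  \<comment> \<open>Now \<mu> = k (X - \<beta>), so \<beta> is a quotient of two coefficients that
    lie in \<open>adjoin \<theta>\<close>.\<close>
  have co: "coeff \<mu> 0 = - (\<beta> * k)" "coeff \<mu> 1 = k" by (simp_all add: \<nu> k)
  have "coeff \<mu> 0 \<in> adjoin \<theta>" "coeff \<mu> 1 \<in> adjoin \<theta>" using \<mu>(2) by (simp_all add: S_def)
  then have "- (\<beta> * k) \<in> adjoin \<theta>" "k \<in> adjoin \<theta>" by (simp_all only: co)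
  then have "- (- (\<beta> * k)) * inverse k \<in> adjoin \<theta>"
    by (rule adjoin_mult[OF adjoin_uminus adjoin_inverse[OF alg]])
  moreover have "- (- (\<beta> * k)) * inverse k = \<beta>" using \<open>k \<noteq> 0\<close> by simp
  ultimately have \<beta>: "\<beta> \<in> adjoin \<theta>" by (simp only:)
  have "\<theta> - of_int (int c) * \<beta> \<in> adjoin \<theta>"
    by (intro adjoin_diff adjoin_mult adjoin_of_int adjoin_generator \<beta>)
  then show ?thesis using alg \<beta> by (auto simp: \<theta>_def)
qed

lemma finite_primitive_element:
  fixes X :: "complex set"
  assumes "finite X" "\<And>x. x \<in> X \<Longrightarrow> algebraic x"
  shows "\<exists>\<theta>. algebraic \<theta> \<and> X \<subseteq> adjoin \<theta>"
  using assms
proof (induction X rule: finite_induct)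
  case empty
  show ?case using algebraic_int_imp_algebraic by (auto intro!: exI[of _ 0])
next
  case (insert x X)
  then obtain \<theta> where \<theta>: "algebraic \<theta>" "X \<subseteq> adjoin \<theta>" by auto
  obtain \<theta>' where \<theta>': "algebraic \<theta>'" "\<theta> \<in> adjoin \<theta>'" "x \<in> adjoin \<theta>'"
    using primitive_element[OF \<theta>(1), of x] insert.prems by auto
  then obtain v where v: "\<theta> = ev v \<theta>'" by (auto simp: adjoin_def)
  have "y \<in> adjoin \<theta>'" if y: "y \<in> X" for y
  proof -
    obtain u where "y = ev u \<theta>" using subsetD[OF \<theta>(2) y] by (auto simp: adjoin_def)
    then have "y = ev (pcompose u v) \<theta>'" by (simp add: v)
    then show ?thesis unfolding adjoin_def by blast
  qed
  then show ?case using \<theta>' by auto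
qed

section \<open>Heights of rational functions\<close>

lemma prod_smult_poly:
  fixes p :: "'i \<Rightarrow> 'a :: comm_ring_1 poly"
  shows "(\<Prod>i\<in>A. smult (c i) (p i)) = smult (\<Prod>i\<in>A. c i) (\<Prod>i\<in>A. p i)"
  by (induction A rule: infinite_finite_induct) (auto simp: mult.commute)

lemma smult_sum_right: "smult a (\<Sum>i\<in>A. f i) = (\<Sum>i\<in>A. smult a (f i))"
  by (induction A rule: infinite_finite_induct) (auto simp: smult_add_right)

lemma integral_coeffs_mult:
  assumes "\<And>n. integral_el (coeff p n)" "\<And>n. integral_el (coeff q n)"
  shows "integral_el (coeff (p * q) n)"
  unfolding coeff_mult using assms by (intro integral_el_sum integral_el_mult)

lemma integral_coeffs_prod:
  assumes "\<And>i n. i \<in> A \<Longrightarrow> integral_el (coeff (p i) n)"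
  shows "integral_el (coeff (\<Prod>i\<in>A. p i) n)"
  using assms
  by (induction A arbitrary: n rule: infinite_finite_induct) (auto intro: integral_coeffs_mult)

lemma integral_coeffs_power:
  assumes "\<And>n. integral_el (coeff p n)"
  shows "integral_el (coeff (p ^ k) n)"
  using assms by (induction k arbitrary: n) (auto intro: integral_coeffs_mult)

lemma map_poly_of_int_power:
  "map_poly of_int (p ^ n) = (map_poly of_int p ^ n :: complex poly)"
  by (induction n) (simp_all add: map_poly_of_int_mult)

lemma content_power_eq_1: "content p = 1 \<Longrightarrow> content (p ^ n) = (1 :: int)"
  by (induction n) (auto simp: content_mult)

text \<open>The denominator of \<kappa> in lowest terms divides every coefficient of P, hence its
  content.\<close>

lemma primitive_scale_integer:
  fixes P :: "int poly" and \<kappa> :: rat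
  assumes "content P = 1" "\<And>n. \<kappa> * of_int (coeff P n) \<in> \<int>"
  shows "\<kappa> \<in> \<int>"
proof -
  obtain s t where st: "t > 0" "coprime s t" "\<kappa> = of_int s / of_int t"
    using Rat_cases[of \<kappa>] Fract_of_int_quotient by metis
  have "t dvd coeff P n" for n
  proof -
    obtain k where "\<kappa> * of_int (coeff P n) = of_int k" using assms(2) by (auto elim: Ints_cases)
    then have "(of_int (s * coeff P n) :: rat) = of_int (t * k)"
      using st(1) by (simp add: st(3) field_simps)
    then have "t dvd s * coeff P n" by (metis dvd_triv_left of_int_eq_iff)
    then show ?thesis using st(2) by (simp add: coprime_commute coprime_dvd_mult_right_iff)
  qed
  then have "[:t:] dvd P" by (simp add: const_poly_dvd_iff)
  then have "t dvd content P" by (simp add: const_poly_dvd_iff_dvd_content)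
  then show ?thesis using st(1,3) assms(1) by simp
qed

text \<open>The polynomial \<open>N \<Prod> (q\<^sub>w X - p\<^sub>w)\<close> is proportional to the characteristic polynomial of
  \<open>p/q\<close> and its \<open>r\<close>-th power has integer coefficients, so that it is a multiple of the \<open>r\<close>-th power
  of the primitive one.\<close>

lemma height_quotient_bound:
  fixes M :: "'e \<Rightarrow> rat poly" and pc qc :: "'e \<Rightarrow> int" and N :: real
  assumes "algebraic \<theta>" "finite E" "N > 0" "r > 0" "N ^ r \<in> \<int>"
    and "\<And>g. g \<in> PiE (conjugates \<theta>) (\<lambda>_. E) \<Longrightarrow>
      integral_el (of_real N * (\<Prod>w\<in>conjugates \<theta>. ev (M (g w)) w))"
  defines "p \<equiv> \<Sum>e\<in>E. smult (of_int (pc e)) (M e)" and "q \<equiv> \<Sum>e\<in>E. smult (of_int (qc e)) (M e)"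
  assumes "ev q \<theta> \<noteq> 0" "ev u \<theta> * ev q \<theta> = ev p \<theta>"
  shows "real (card (conjugates \<theta>)) * weil_height (ev u \<theta>) \<le>
    ln N + (\<Sum>w\<in>conjugates \<theta>. ln (max (cmod (ev q w)) (cmod (ev p w))))"
proof -
  define W where "W = conjugates \<theta>"
  have fin: "finite W" using min_int_poly_factorization(1)[OF assms(1)] by (simp add: W_def)
  note self = self_in_conjugates[OF assms(1)]
  have q0: "ev q w \<noteq> 0" if "w \<in> W" for w
    using ev_conjugate_eq_0[OF assms(1) _ self] that assms(9) by (auto simp: W_def)
  have uqp: "ev u w * ev q w = ev p w" if "w \<in> W" for w
    using ev_conjugate_eq_0[OF assms(1) self, of w "u * q - p"] that assms(10) by (simp add: W_def)
  obtain P :: "int poly" where P: "content P = 1" "lead_coeff P > 0"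
    "map_poly of_int P = smult (of_int (lead_coeff P)) (\<Prod>w\<in>W. [:- ev u w, 1:])"
    "real (card W) * weil_height (ev u \<theta>) =
       ln (real_of_int (lead_coeff P)) + (\<Sum>w\<in>W. ln (max 1 (cmod (ev u w))))"
    unfolding W_def by (rule field_height[OF assms(1)])
  define A where "A = lead_coeff P"
  have "A > 0" using P(2) by (simp only: A_def)
  define Q where "Q = (\<Prod>w\<in>W. ev q w)"
  have "Q \<noteq> 0" using q0 fin by (simp add: Q_def)
  define G where "G = smult (of_real N) (\<Prod>w\<in>W. [:- ev p w, ev q w:])"
  have lin: "[:- ev p w, ev q w:] = (\<Sum>e\<in>E. smult (ev (M e) w) [:of_int (- pc e), of_int (qc e):])" for w
    by (rule poly_eqI) (auto simp: coeff_sum p_def q_def coeff_pCons sum_negf mult.commute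
        split: nat.splits)
  \<comment> \<open>Expanding the product picks one monomial \<open>M (g w)\<close> for each
    conjugate w; these are the products whose integrality is assumed.\<close>
  have G1: "G = (\<Sum>g\<in>PiE W (\<lambda>_. E). smult (of_real N * (\<Prod>w\<in>W. ev (M (g w)) w))
      (\<Prod>w\<in>W. [:of_int (- pc (g w)), of_int (qc (g w)):]))"
    unfolding G_def lin
    by (subst prod_sum_PiE) (use fin assms(2) in \<open>simp_all add: prod_smult_poly smult_sum_right del: smult_pCons\<close>)
  have "integral_el (coeff G n)" for n
    unfolding G1 coeff_sum coeff_smult
  proof (rule integral_el_sum, rule integral_el_mult)
    fix g assume "g \<in> PiE W (\<lambda>_. E)"
    then show "integral_el (of_real N * (\<Prod>w\<in>W. ev (M (g w)) w))"
      using assms(6) by (simp add: W_def)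
    have "integral_el (coeff [:of_int a, of_int b:] n)" for a b n
      by (auto simp: coeff_pCons split: nat.splits)
    then show "integral_el (coeff (\<Prod>w\<in>W. [:of_int (- pc (g w)), of_int (qc (g w)):]) n)"
      by (intro integral_coeffs_prod)
  qed
  then have Gr_int: "integral_el (coeff (G ^ r) n)" for n by (rule integral_coeffs_power)
  have "[:- ev p w, ev q w:] = smult (ev q w) [:- ev u w, 1:]" if "w \<in> W" for w
    using uqp[OF that] by (simp add: mult.commute)
  then have "(\<Prod>w\<in>W. [:- ev p w, ev q w:]) = smult Q (\<Prod>w\<in>W. [:- ev u w, 1:])"
    by (simp add: prod_smult_poly[symmetric] Q_def cong: prod.cong)
  then have "smult (of_int A) G = smult (of_real N * Q) (map_poly of_int P)"
    using P(3) by (simp add: G_def A_def mult_ac)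
  then have "smult (of_int A) G ^ r = smult (of_real N * Q) (map_poly of_int P) ^ r" by simp
  then have Gr: "smult (of_int (A ^ r)) (G ^ r) =
      smult (of_real (N ^ r) * Q ^ r) (map_poly of_int (P ^ r))"
    by (simp add: smult_power map_poly_of_int_power power_mult_distrib)
  \<comment> \<open>N may be irrational, as the real n-th root in
    \<open>weil_height_power_ge\<close>; passing to r-th powers is what makes the factor \<kappa>
    rational.\<close>
  obtain z where z: "N ^ r = of_int z" using assms(5) by (auto elim: Ints_cases)
  obtain Q' where Q': "Q = of_rat Q'"
    using norm_rational[OF assms(1), of q] by (auto simp: Q_def W_def elim: Rats_cases)
  define \<kappa> where "\<kappa> = of_int z * Q' ^ r / of_int (A ^ r)"
  have "\<kappa> * of_int (coeff (P ^ r) n) \<in> \<int>" for n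
  proof (rule integral_el_rational)
    have "of_int (A ^ r) * coeff (G ^ r) n = of_int z * Q ^ r * of_int (coeff (P ^ r) n)"
      using arg_cong[OF Gr, of "\<lambda>p. coeff p n"] z by (simp add: coeff_map_poly)
    then have "coeff (G ^ r) n = of_int z * Q ^ r * of_int (coeff (P ^ r) n) / of_int (A ^ r)"
      using \<open>A > 0\<close> by (simp add: nonzero_eq_divide_eq mult_ac)
    then have "of_rat (\<kappa> * of_int (coeff (P ^ r) n)) = coeff (G ^ r) n"
      by (simp add: \<kappa>_def Q' of_rat_mult of_rat_divide of_rat_power)
    then show "integral_el (of_rat (\<kappa> * of_int (coeff (P ^ r) n)))" using Gr_int by simp
  qed
  then have "\<kappa> \<in> \<int>" by (rule primitive_scale_integer[OF content_power_eq_1[OF P(1)]])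
  then obtain k where k: "\<kappa> = of_int k" by (auto elim: Ints_cases)
  have eq: "N ^ r * cmod Q ^ r = real_of_int (\<bar>k\<bar> * A ^ r)"
  proof -
    have "of_int z * Q' ^ r = of_int k * of_int (A ^ r)"
      using k \<open>A > 0\<close> by (simp add: \<kappa>_def nonzero_divide_eq_eq)
    then have "of_rat (of_int z * Q' ^ r) = (of_rat (of_int k * of_int (A ^ r)) :: complex)" by simp
    then have "of_real (N ^ r) * Q ^ r = of_int k * of_int (A ^ r)"
      by (simp add: z Q' of_rat_mult of_rat_power)
    then have "cmod (of_real (N ^ r) * Q ^ r) = cmod (of_int k * of_int (A ^ r))" by simp
    then show ?thesis
      using \<open>A > 0\<close> assms(3) by (simp add: norm_mult norm_power abs_mult)
  qed
  \<comment> \<open>A nonzero integer has absolute value at least 1. In place of the product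
    formula, this bounds A by N times the absolute norm of the denominator q.\<close>
  have "k \<noteq> 0" using eq assms(3) \<open>Q \<noteq> 0\<close> by auto
  then have "1 * A ^ r \<le> \<bar>k\<bar> * A ^ r" using P(2) by (intro mult_right_mono) (auto simp: A_def)
  then have "real_of_int A ^ r \<le> (N * cmod Q) ^ r"
    using eq by (metis mult_1 of_int_le_iff of_int_power power_mult_distrib)
  then have AN: "real_of_int A \<le> N * cmod Q"
    using assms(3,4) P(2) by (subst (asm) power_mono_iff) (auto simp: A_def)
  have "ln (real_of_int A) \<le> ln (N * cmod Q)"
    using AN \<open>A > 0\<close> by simp
  then have "ln (real_of_int A) \<le> ln N + ln (cmod Q)"
    using assms(3) \<open>Q \<noteq> 0\<close> by (simp add: ln_mult)
  moreover have "ln (cmod Q) = (\<Sum>w\<in>W. ln (cmod (ev q w)))"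
    using q0 by (simp add: Q_def prod_norm[symmetric] ln_prod fin)
  ultimately have "real (card W) * weil_height (ev u \<theta>) \<le>
      ln N + (\<Sum>w\<in>W. ln (cmod (ev q w)) + ln (max 1 (cmod (ev u w))))"
    using P(4) by (simp add: A_def sum.distrib)
  also have "(\<Sum>w\<in>W. ln (cmod (ev q w)) + ln (max 1 (cmod (ev u w)))) =
      (\<Sum>w\<in>W. ln (max (cmod (ev q w)) (cmod (ev p w))))"
  proof (rule sum.cong)
    fix w assume w: "w \<in> W"
    have "ln (cmod (ev q w)) + ln (max 1 (cmod (ev u w))) = ln (cmod (ev q w) * max 1 (cmod (ev u w)))"
      using q0[OF w] by (subst ln_mult) auto
    also have "cmod (ev q w) * max 1 (cmod (ev u w)) = max (cmod (ev q w)) (cmod (ev p w))"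
      using uqp[OF w, symmetric] by (simp add: max_mult_distrib_left norm_mult mult.commute)
    finally show "ln (cmod (ev q w)) + ln (max 1 (cmod (ev u w))) = ln (max (cmod (ev q w)) (cmod (ev p w)))" .
  qed simp
  finally show ?thesis by (simp add: W_def)
qed

lemma card_conjugates_pos: "algebraic \<theta> \<Longrightarrow> card (conjugates \<theta>) > 0"
  using min_int_poly_factorization(3) degree_min_int_poly_pos by simp

text \<open>Numerator and denominator share the monomials in E, so each variable is charged its
  maximal degree once, however many terms occur. Only the coefficients add up, to at most L at the
  archimedean places.\<close>

lemma weil_height_rational_function:
  fixes x y z \<alpha> :: complex and pc qc :: "nat \<times> nat \<times> nat \<Rightarrow> int"
  assumes "algebraic x" "algebraic y" "algebraic z" "algebraic \<alpha>"
    and "E \<subseteq> {..d1} \<times> {..d2} \<times> {..d3}"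
    and "(\<Sum>(i, j, k)\<in>E. of_int (qc (i, j, k)) * (x ^ i * y ^ j * z ^ k)) \<noteq> 0"
    and "\<alpha> * (\<Sum>(i, j, k)\<in>E. of_int (qc (i, j, k)) * (x ^ i * y ^ j * z ^ k)) =
      (\<Sum>(i, j, k)\<in>E. of_int (pc (i, j, k)) * (x ^ i * y ^ j * z ^ k))"
    and "real_of_int (\<Sum>e\<in>E. \<bar>pc e\<bar>) \<le> L" "real_of_int (\<Sum>e\<in>E. \<bar>qc e\<bar>) \<le> L"
  shows "weil_height \<alpha> \<le> real d1 * weil_height x + real d2 * weil_height y + real d3 * weil_height z + ln L"
proof -
  have finE: "finite E" using assms(5) by (rule finite_subset) auto
  have "\<exists>\<theta>. algebraic \<theta> \<and> {x, y, z, \<alpha>} \<subseteq> adjoin \<theta>"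
    using assms by (intro finite_primitive_element) auto
  then obtain \<theta> a b c u where \<theta>: "algebraic \<theta>"
    and abc: "x = ev a \<theta>" "y = ev b \<theta>" "z = ev c \<theta>" "\<alpha> = ev u \<theta>"
    unfolding adjoin_def by auto
  define W where "W = conjugates \<theta>"
  have fin: "finite W" using min_int_poly_factorization(1)[OF \<theta>] by (simp add: W_def)
  define D where "D = real (card W)"
  have "D > 0" using card_conjugates_pos[OF \<theta>] by (simp add: D_def W_def)
  have fh: "\<exists>A::int. A > 0 \<and> (\<forall>n. integral_el (coeff (smult (of_int A) (\<Prod>w\<in>W. [:- ev t w, 1:])) n))
      \<and> D * weil_height (ev t \<theta>) = ln (real_of_int A) + (\<Sum>w\<in>W. ln (max 1 (cmod (ev t w))))" for t
  proof -
    obtain P :: "int poly" where P: "lead_coeff P > 0"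
      "map_poly of_int P = smult (of_int (lead_coeff P)) (\<Prod>w\<in>W. [:- ev t w, 1:])"
      "D * weil_height (ev t \<theta>) =
        ln (real_of_int (lead_coeff P)) + (\<Sum>w\<in>W. ln (max 1 (cmod (ev t w))))"
      unfolding W_def D_def using field_height[OF \<theta>] by metis
    have "integral_el (coeff (map_poly of_int P) n)" for n by (simp add: coeff_map_poly)
    then show ?thesis using P by metis
  qed
  obtain A where A: "A > 0" "\<And>n. integral_el (coeff (smult (of_int A) (\<Prod>w\<in>W. [:- ev a w, 1:])) n)"
    "D * weil_height x = ln (real_of_int A) + (\<Sum>w\<in>W. ln (max 1 (cmod (ev a w))))"
    using fh[of a] abc by blast
  obtain B where B: "B > 0" "\<And>n. integral_el (coeff (smult (of_int B) (\<Prod>w\<in>W. [:- ev b w, 1:])) n)"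
    "D * weil_height y = ln (real_of_int B) + (\<Sum>w\<in>W. ln (max 1 (cmod (ev b w))))"
    using fh[of b] abc by blast
  obtain C where C: "C > 0" "\<And>n. integral_el (coeff (smult (of_int C) (\<Prod>w\<in>W. [:- ev c w, 1:])) n)"
    "D * weil_height z = ln (real_of_int C) + (\<Sum>w\<in>W. ln (max 1 (cmod (ev c w))))"
    using fh[of c] abc by blast
  \<comment> \<open>With one monomial per conjugate, each conjugate of x occurs with exponent at
    most d1, so d1 factors A restore integrality; likewise for y and z.\<close>
  define N where "N = real_of_int (A ^ d1 * B ^ d2 * C ^ d3)"
  define M where "M = (\<lambda>(i, j, k). a ^ i * b ^ j * c ^ k)"
  define p where "p = (\<Sum>e\<in>E. smult (of_int (pc e)) (M e))"
  define q where "q = (\<Sum>e\<in>E. smult (of_int (qc e)) (M e))"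
  have evpq: "ev p w = (\<Sum>(i, j, k)\<in>E. of_int (pc (i, j, k)) * (ev a w ^ i * ev b w ^ j * ev c w ^ k))"
    "ev q w = (\<Sum>(i, j, k)\<in>E. of_int (qc (i, j, k)) * (ev a w ^ i * ev b w ^ j * ev c w ^ k))" for w
    by (simp_all add: p_def q_def M_def case_prod_beta)
  have "q \<noteq> 0" "ev q \<theta> \<noteq> 0" using assms(6) evpq(2)[of \<theta>] abc by auto
  have eqn: "ev u \<theta> * ev q \<theta> = ev p \<theta>" using assms(7) evpq[of \<theta>] abc by simp
  have bound: "D * weil_height (ev u \<theta>) \<le> ln N + (\<Sum>w\<in>W. ln (max (cmod (ev q w)) (cmod (ev p w))))"
    unfolding D_def W_def p_def q_def
  proof (rule height_quotient_bound[where r = 1])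
    show "algebraic \<theta>" "finite E" by fact+
    show "N > 0" using A(1) B(1) C(1) by (simp add: N_def)
    show "N ^ 1 \<in> \<int>" by (simp only: N_def power_one_right Ints_of_int)
    show "ev (\<Sum>e\<in>E. smult (of_int (qc e)) (M e)) \<theta> \<noteq> 0"
      "ev u \<theta> * ev (\<Sum>e\<in>E. smult (of_int (qc e)) (M e)) \<theta> = ev (\<Sum>e\<in>E. smult (of_int (pc e)) (M e)) \<theta>"
      unfolding p_def[symmetric] q_def[symmetric] by fact+
    fix g assume g: "g \<in> PiE (conjugates \<theta>) (\<lambda>_. E)"
    define e1 e2 e3 where "e1 w = fst (g w)" and "e2 w = fst (snd (g w))" and "e3 w = snd (snd (g w))" for w
    have le: "e1 w \<le> d1" "e2 w \<le> d2" "e3 w \<le> d3" if "w \<in> W" for w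
    proof -
      have "g w \<in> {..d1} \<times> {..d2} \<times> {..d3}"
        using g that assms(5) by (auto simp: W_def PiE_iff)
      then show "e1 w \<le> d1" "e2 w \<le> d2" "e3 w \<le> d3" by (auto simp: e1_def e2_def e3_def)
    qed
    have "(\<Prod>w\<in>W. ev (M (g w)) w) = (\<Prod>w\<in>W. ev a w ^ e1 w) * (\<Prod>w\<in>W. ev b w ^ e2 w) * (\<Prod>w\<in>W. ev c w ^ e3 w)"
      by (simp add: M_def case_prod_beta e1_def e2_def e3_def prod.distrib)
    then have "of_real N * (\<Prod>w\<in>W. ev (M (g w)) w) =
        (of_int A ^ d1 * (\<Prod>w\<in>W. ev a w ^ e1 w)) * (of_int B ^ d2 * (\<Prod>w\<in>W. ev b w ^ e2 w)) *
        (of_int C ^ d3 * (\<Prod>w\<in>W. ev c w ^ e3 w))"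
      by (simp add: N_def)
    also have "integral_el \<dots>"
      using le by (intro integral_el_mult integral_el_bounded_exponents[OF fin A(2)]
          integral_el_bounded_exponents[OF fin B(2)] integral_el_bounded_exponents[OF fin C(2)])
    finally show "integral_el (of_real N * (\<Prod>w\<in>conjugates \<theta>. ev (M (g w)) w))" by (simp add: W_def)
  qed simp
  have "L > 0"
  proof -
    obtain e where "e \<in> E" "qc e \<noteq> 0"
      using assms(6) by (auto elim!: sum.not_neutral_contains_not_neutral)
    then have "(\<Sum>e\<in>E. \<bar>qc e\<bar>) > 0" using finE by (intro sum_pos2[of _ e]) auto
    then show ?thesis using assms(9) by linarith
  qed
  have main: "ln (max (cmod (ev q w)) (cmod (ev p w))) \<le> ln L + real d1 * ln (max 1 (cmod (ev a w))) +
      real d2 * ln (max 1 (cmod (ev b w))) + real d3 * ln (max 1 (cmod (ev c w)))" if w: "w \<in> W" for w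
  proof -
    define m1 m2 m3 where "m1 = max 1 (cmod (ev a w))" and "m2 = max 1 (cmod (ev b w))"
      and "m3 = max 1 (cmod (ev c w))"
    have ge1: "m1 \<ge> 1" "m2 \<ge> 1" "m3 \<ge> 1" by (simp_all add: m1_def m2_def m3_def)
    have pw: "cmod t ^ i \<le> max 1 (cmod t) ^ d" if "i \<le> d" for t i d
    proof -
      have "cmod t ^ i \<le> max 1 (cmod t) ^ i" by (intro power_mono) auto
      also have "\<dots> \<le> max 1 (cmod t) ^ d" using that by (intro power_increasing) auto
      finally show ?thesis .
    qed
    have bd: "cmod (\<Sum>(i, j, k)\<in>E. of_int (h (i, j, k)) * (ev a w ^ i * ev b w ^ j * ev c w ^ k)) \<le>
        L * (m1 ^ d1 * m2 ^ d2 * m3 ^ d3)" if h: "real_of_int (\<Sum>e\<in>E. \<bar>h e\<bar>) \<le> L" for h :: "nat \<times> nat \<times> nat \<Rightarrow> int"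
    proof -
      have "cmod (\<Sum>(i, j, k)\<in>E. of_int (h (i, j, k)) * (ev a w ^ i * ev b w ^ j * ev c w ^ k)) \<le>
        (\<Sum>e\<in>E. real_of_int \<bar>h e\<bar> * (m1 ^ d1 * m2 ^ d2 * m3 ^ d3))"
      proof (rule sum_norm_le)
        fix e assume "e \<in> E"
        then obtain i j k where e: "e = (i, j, k)" "i \<le> d1" "j \<le> d2" "k \<le> d3" using assms(5) by auto
        have "cmod (ev a w ^ i * ev b w ^ j * ev c w ^ k) \<le> m1 ^ d1 * m2 ^ d2 * m3 ^ d3"
          unfolding norm_mult norm_power m1_def m2_def m3_def using e
          by (intro mult_mono pw) auto
        then show "cmod (case e of (i, j, k) \<Rightarrow> of_int (h (i, j, k)) * (ev a w ^ i * ev b w ^ j * ev c w ^ k))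
            \<le> real_of_int \<bar>h e\<bar> * (m1 ^ d1 * m2 ^ d2 * m3 ^ d3)"
          by (simp add: e norm_mult mult_left_mono)
      qed
      also have "\<dots> = real_of_int (\<Sum>e\<in>E. \<bar>h e\<bar>) * (m1 ^ d1 * m2 ^ d2 * m3 ^ d3)"
        by (simp add: sum_distrib_right)
      also have "\<dots> \<le> L * (m1 ^ d1 * m2 ^ d2 * m3 ^ d3)"
        using h ge1 by (intro mult_right_mono) auto
      finally show ?thesis .
    qed
    have "ev q w \<noteq> 0"
      using ev_conjugate_eq_0[OF \<theta> _ self_in_conjugates[OF \<theta>], of w q] w \<open>ev q \<theta> \<noteq> 0\<close> by (auto simp: W_def)
    then have "ln (max (cmod (ev q w)) (cmod (ev p w))) \<le> ln (L * (m1 ^ d1 * m2 ^ d2 * m3 ^ d3))"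
      using bd[OF assms(8)] bd[OF assms(9)] by (intro ln_mono) (auto simp: evpq less_max_iff_disj)
    also have "\<dots> = ln L + (real d1 * ln m1 + real d2 * ln m2 + real d3 * ln m3)"
      using ge1 \<open>L > 0\<close> by (simp add: ln_mult ln_realpow)
    finally show ?thesis by (simp add: m1_def m2_def m3_def)
  qed
  have "D * weil_height \<alpha> \<le> ln N + (\<Sum>w\<in>W. ln L + real d1 * ln (max 1 (cmod (ev a w))) +
      real d2 * ln (max 1 (cmod (ev b w))) + real d3 * ln (max 1 (cmod (ev c w))))"
    using bound sum_mono[OF main] abc by fastforce
  also have "\<dots> = D * (real d1 * weil_height x + real d2 * weil_height y + real d3 * weil_height z + ln L)"
  proof -
    have "ln N = real d1 * ln (real_of_int A) + real d2 * ln (real_of_int B) + real d3 * ln (real_of_int C)"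
      using A(1) B(1) C(1) by (simp add: N_def ln_mult ln_realpow)
    moreover have "D * (real d1 * weil_height x) = real d1 * (D * weil_height x)"
      "D * (real d2 * weil_height y) = real d2 * (D * weil_height y)"
      "D * (real d3 * weil_height z) = real d3 * (D * weil_height z)" by simp_all
    ultimately show ?thesis
      unfolding distrib_left A(3) B(3) C(3)
      by (simp add: sum.distrib sum_distrib_left D_def)
  qed
  finally show ?thesis using \<open>D > 0\<close> by simp
qed

section \<open>Pade approximation of powers\<close>

definition l1_norm :: "int poly \<Rightarrow> int" where
  "l1_norm p = (\<Sum>i\<le>degree p. \<bar>coeff p i\<bar>)"

lemma l1_norm_eq: "degree p \<le> n \<Longrightarrow> l1_norm p = (\<Sum>i\<le>n. \<bar>coeff p i\<bar>)"
  unfolding l1_norm_def by (rule sum.mono_neutral_left) (auto simp: coeff_eq_0)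

lemma l1_norm_0 [simp]: "l1_norm 0 = 0" by (simp add: l1_norm_def)

lemma l1_norm_pCons [simp]: "l1_norm (pCons a p) = \<bar>a\<bar> + l1_norm p"
  by (subst l1_norm_eq[of _ "Suc (degree p)"])
    (auto simp: l1_norm_def degree_pCons_le sum.atMost_Suc_shift simp del: sum.atMost_Suc)

lemma l1_norm_add: "l1_norm (p + q) \<le> l1_norm p + l1_norm q"
proof -
  define n where "n = max (degree p) (degree q)"
  have "degree p \<le> n" "degree q \<le> n" "degree (p + q) \<le> n"
    by (simp_all add: n_def degree_add_le)
  then show ?thesis
    by (simp add: l1_norm_eq[of _ n] sum.distrib[symmetric] sum_mono abs_triangle_ineq)
qed

lemma l1_norm_smult: "l1_norm (smult c p) = \<bar>c\<bar> * l1_norm p"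
  by (induction p) (simp_all add: abs_mult distrib_left)

lemma l1_norm_uminus: "l1_norm (- p) = l1_norm p"
  using l1_norm_smult[of "-1" p] by simp

lemma l1_norm_mult: "l1_norm (p * q) \<le> l1_norm p * l1_norm q"
proof (induction p)
  case (pCons a p)
  have "l1_norm (pCons a p * q) \<le> l1_norm (smult a q) + l1_norm (pCons 0 (p * q))"
    using l1_norm_add[of "smult a q" "pCons 0 (p * q)"] by simp
  also have "\<dots> \<le> \<bar>a\<bar> * l1_norm q + l1_norm p * l1_norm q"
    using pCons.IH by (simp add: l1_norm_smult)
  finally show ?case by (simp add: distrib_right)
qed simp

lemma l1_norm_monom_mult: "l1_norm (monom 1 n * p) = l1_norm p"
  by (induction n) (simp_all add: monom_Suc flip: one_pCons)

text \<open>Each Horner step multiplies by 1 - X, which has length 2.\<close>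

lemma l1_norm_reflect:
  assumes "degree p \<le> n"
  shows "l1_norm (pcompose p [:1, -1:]) \<le> 2 ^ n * l1_norm p"
  using assms
proof (induction p arbitrary: n)
  case (pCons a p)
  have "1 * \<bar>a\<bar> \<le> 2 ^ n * \<bar>a\<bar>" by (rule mult_right_mono) auto
  then have a: "\<bar>a\<bar> \<le> 2 ^ n * \<bar>a\<bar>" by (simp only: mult_1_left)
  show ?case
  proof (cases "p = 0")
    case False
    with pCons.prems obtain m where n: "n = Suc m" "degree p \<le> m" by (cases n) auto
    have "l1_norm (pcompose (pCons a p) [:1, -1:]) \<le>
        \<bar>a\<bar> + l1_norm ([:1, -1:] * pcompose p [:1, -1:])"
      using l1_norm_add[of "[:a:]"] by (simp add: pcompose_pCons del: mult_pCons_left)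
    also have "\<dots> \<le> \<bar>a\<bar> + l1_norm [:1, -1:] * l1_norm (pcompose p [:1, -1:])"
      using l1_norm_mult by (rule add_left_mono)
    also have "\<dots> \<le> \<bar>a\<bar> + 2 * (2 ^ m * l1_norm p)"
      using pCons.IH[OF n(2)] by simp
    also have "\<dots> \<le> 2 ^ n * \<bar>a\<bar> + 2 ^ n * l1_norm p"
      using a by (simp add: n)
    finally show ?thesis by (simp add: distrib_left)
  next
    case True
    then show ?thesis using a by (simp add: pcompose_pCons)
  qed
qed simp

section \<open>Higher derivatives and the reflection of X to 1 - X\<close>

lemma fact_mult_pochhammer: "fact n * pochhammer (of_nat (Suc n)) k = (fact (n + k) :: 'a :: field_char_0)"
proof (induction k)
  case (Suc k)
  have "fact n * pochhammer (of_nat (Suc n)) (Suc k) =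
      fact n * pochhammer (of_nat (Suc n)) k * (of_nat (Suc n) + of_nat k :: 'a)"
    by (simp only: pochhammer_Suc mult.assoc)
  also have "\<dots> = fact (n + Suc k)"
    unfolding Suc.IH by (simp add: algebra_simps)
  finally show ?case .
qed simp

lemma degree_le_of_higher_pderiv_eq_0:
  fixes p :: "int poly"
  assumes "(pderiv ^^ Suc n) p = 0"
  shows "degree p \<le> n"
proof (rule degree_le, intro allI impI)
  fix i assume "n < i"
  then obtain k where k: "i = k + Suc n" by (metis less_imp_Suc_add add_Suc_right add.commute)
  have "pochhammer (of_nat (Suc k)) (Suc n) * coeff p i = 0"
    using coeff_higher_pderiv[of "Suc n" p k] assms by (simp only: k coeff_0)
  moreover have "pochhammer (of_nat (Suc k)) (Suc n) > (0 :: int)" by (rule pochhammer_pos) simp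
  ultimately show "coeff p i = 0" by simp
qed

lemma higher_pderiv_reflect:
  "(pderiv ^^ n) (pcompose p [:1, -1:]) = smult ((-1) ^ n) (pcompose ((pderiv ^^ n) p) [:1, -1 :: int:])"
proof (induction n)
  case (Suc n)
  then show ?case
    by (simp add: pderiv_smult pderiv_pcompose pderiv_pCons)
qed simp

lemma pcompose_reflect_reflect:
  fixes p :: "int poly"
  shows "pcompose (pcompose p [:1, -1:]) [:1, -1:] = p"
proof -
  have "pcompose [:1, -1:] [:1, -1 :: int:] = [:0, 1:]" by (simp add: pcompose_pCons)
  then show ?thesis by (simp add: pcompose_assoc[symmetric] pcompose_idR)
qed

lemma pcompose_monom: "pcompose (monom 1 n) q = (q ^ n :: int poly)"
  by (induction n) (simp_all add: monom_Suc pcompose_pCons pcompose_1 flip: one_pCons)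

lemma coeff_one_minus_X_power: "coeff ([:1, -1:] ^ n) i = (-1) ^ i * int (n choose i)"
proof (cases "i \<le> n")
  case True
  then show ?thesis by (simp add: coeff_linear_poly_power)
next
  case False
  then have "degree ([:1, -1 :: int:] ^ n) < i"
    using degree_power_le[of "[:1, -1 :: int:]" n] by simp
  then show ?thesis using False by (simp add: coeff_eq_0 binomial_eq_0)
qed

text \<open>These are the Pade approximants of type \<open>(n, n, n)\<close> to the system \<open>1, z\<^sup>2\<^sup>n, (1 - z)\<^sup>2\<^sup>n\<close>. The
  coefficients arise by integrating \<open>z\<^sup>n\<^sup>-\<^sup>1 (1 - z)\<^sup>n\<close> and \<open>z\<^sup>n (1 - z)\<^sup>n\<^sup>-\<^sup>1\<close> exactly \<open>n + 1\<close> times,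
  where \<open>n = Suc m\<close>.\<close>

definition pade_b :: "nat \<Rightarrow> int poly" where
  "pade_b m = (\<Sum>j\<le>Suc m. monom ((-1) ^ j * int ((3 * Suc m choose (Suc m - j)) * (m + j choose j))) j)"

definition pade_c :: "nat \<Rightarrow> int poly" where
  "pade_c m = (\<Sum>j\<le>m. monom ((-1) ^ j * int ((3 * Suc m choose (m - j)) * (Suc m + j choose j))) (Suc j))"

lemma coeff_pade_b:
  "coeff (pade_b m) j = (if j \<le> Suc m then (-1) ^ j * int ((3 * Suc m choose (Suc m - j)) * (m + j choose j)) else 0)"
  unfolding pade_b_def coeff_sum coeff_monom by (subst sum.delta) auto

lemma coeff_pade_c_Suc:
  "coeff (pade_c m) (Suc j) = (if j \<le> m then (-1) ^ j * int ((3 * Suc m choose (m - j)) * (Suc m + j choose j)) else 0)"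
  unfolding pade_c_def coeff_sum coeff_monom by (simp only: nat.inject) (subst sum.delta, auto)

text \<open>Integrating z^n (1 - z)^(n-1) n + 1 times starts at z^(2n+1), one step above the factor
  z^(2n). This zero makes the determinant of the two Pade forms easy to evaluate.\<close>

lemma coeff_pade_c_0: "coeff (pade_c m) 0 = 0"
  by (simp add: pade_c_def coeff_sum)

lemma degree_pade_b: "degree (pade_b m) \<le> Suc m"
  by (rule degree_le) (simp add: coeff_pade_b)

lemma degree_pade_c: "degree (pade_c m) \<le> Suc m"
proof (rule degree_le, intro allI impI)
  fix i assume "Suc m < i"
  then show "coeff (pade_c m) i = 0" by (cases i) (simp_all add: coeff_pade_c_Suc)
qed

text \<open>With n = Suc m, the Pochhammer factor comes from differentiating z^(2n+j) n + 1 times.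
  The factorials cancel to a coefficient of (1 - z)^n up to sign and a factor free of j, which
  explains the binomials in \<open>pade_b\<close>.\<close>

lemma pade_b_coeff_identity:
  assumes "j \<le> Suc m"
  shows "fact m * fact (Suc m) * (pochhammer (of_nat (Suc (m + j))) (Suc (Suc m)) *
      int ((3 * Suc m choose (Suc m - j)) * (m + j choose j))) = fact (3 * Suc m) * int (Suc m choose j)"
proof -
  have p: "pochhammer (of_nat (Suc (m + j))) (Suc (Suc m)) = (fact (2 * Suc m + j) / fact (m + j) :: real)"
  proof -
    have "m + j + Suc (Suc m) = 2 * Suc m + j" by simp
    then show ?thesis
      using fact_mult_pochhammer[of "m + j" "Suc (Suc m)", where 'a = real]
      by (metis fact_nonzero nonzero_mult_div_cancel_left)
  qed
  have b: "real (3 * Suc m choose (Suc m - j)) = fact (3 * Suc m) / (fact (Suc m - j) * fact (2 * Suc m + j))"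
  proof -
    have "3 * Suc m - (Suc m - j) = 2 * Suc m + j" using assms by simp
    then show ?thesis by (subst binomial_fact) (auto simp del: fact_Suc)
  qed
  have c: "real (m + j choose j) = fact (m + j) / (fact j * fact m)"
    by (subst binomial_fact) auto
  have d: "real (Suc m choose j) = fact (Suc m) / (fact j * fact (Suc m - j))"
    using assms by (rule binomial_fact)
  have "real_of_int (fact m * fact (Suc m) * (pochhammer (of_nat (Suc (m + j))) (Suc (Suc m)) *
      int ((3 * Suc m choose (Suc m - j)) * (m + j choose j)))) =
    fact m * fact (Suc m) * (pochhammer (of_nat (Suc (m + j))) (Suc (Suc m)) *
      (real (3 * Suc m choose (Suc m - j)) * real (m + j choose j)))"
    by (simp only: of_int_mult of_int_fact of_int_of_nat_eq of_nat_mult pochhammer_of_int[symmetric])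
  also have "\<dots> = fact (3 * Suc m) * real (Suc m choose j)"
    unfolding p b c d by (simp add: field_simps del: fact_Suc)
  also have "\<dots> = real_of_int (fact (3 * Suc m) * int (Suc m choose j))" by simp
  finally show ?thesis by (simp only: of_int_eq_iff)
qed

lemma pade_c_coeff_identity:
  assumes "j \<le> m"
  shows "fact m * fact (Suc m) * (pochhammer (of_nat (Suc (Suc m + j))) (Suc (Suc m)) *
      int ((3 * Suc m choose (m - j)) * (Suc m + j choose j))) = fact (3 * Suc m) * int (m choose j)"
proof -
  have p: "pochhammer (of_nat (Suc (Suc m + j))) (Suc (Suc m)) = (fact (Suc (2 * Suc m + j)) / fact (Suc m + j) :: real)"
  proof -
    have "Suc m + j + Suc (Suc m) = Suc (2 * Suc m + j)" by simp
    then show ?thesis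
      using fact_mult_pochhammer[of "Suc m + j" "Suc (Suc m)", where 'a = real]
      by (metis fact_nonzero nonzero_mult_div_cancel_left)
  qed
  have b: "real (3 * Suc m choose (m - j)) = fact (3 * Suc m) / (fact (m - j) * fact (Suc (2 * Suc m + j)))"
  proof -
    have "3 * Suc m - (m - j) = Suc (2 * Suc m + j)" using assms by simp
    then show ?thesis by (subst binomial_fact) (auto simp del: fact_Suc)
  qed
  have c: "real (Suc m + j choose j) = fact (Suc m + j) / (fact j * fact (Suc m))"
    by (subst binomial_fact) (auto simp del: fact_Suc)
  have d: "real (m choose j) = fact m / (fact j * fact (m - j))"
    using assms by (rule binomial_fact)
  have "real_of_int (fact m * fact (Suc m) * (pochhammer (of_nat (Suc (Suc m + j))) (Suc (Suc m)) *
      int ((3 * Suc m choose (m - j)) * (Suc m + j choose j)))) =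
    fact m * fact (Suc m) * (pochhammer (of_nat (Suc (Suc m + j))) (Suc (Suc m)) *
      (real (3 * Suc m choose (m - j)) * real (Suc m + j choose j)))"
    by (simp only: of_int_mult of_int_fact of_int_of_nat_eq of_nat_mult pochhammer_of_int[symmetric])
  also have "\<dots> = fact (3 * Suc m) * real (m choose j)"
    unfolding p b c d by (simp add: field_simps del: fact_Suc)
  also have "\<dots> = real_of_int (fact (3 * Suc m) * int (m choose j))" by simp
  finally show ?thesis by (simp only: of_int_eq_iff)
qed

lemma higher_pderiv_pade_b:
  "smult (fact m * fact (Suc m)) ((pderiv ^^ Suc (Suc m)) (monom 1 (2 * Suc m) * pade_b m)) =
   smult (fact (3 * Suc m)) (monom 1 m * [:1, -1:] ^ Suc m)"
proof (rule poly_eqI)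
  fix k
  have L: "coeff ((pderiv ^^ Suc (Suc m)) (monom 1 (2 * Suc m) * pade_b m)) k =
      pochhammer (of_nat (Suc k)) (Suc (Suc m)) * (if k < m then 0 else coeff (pade_b m) (k - m))"
    unfolding coeff_higher_pderiv coeff_monom_mult by auto
  have R: "coeff (monom 1 m * [:1, -1:] ^ Suc m) k =
      (if k < m then 0 else (-1) ^ (k - m) * int (Suc m choose (k - m)))"
    unfolding coeff_monom_mult coeff_one_minus_X_power by auto
  show "coeff (smult (fact m * fact (Suc m)) ((pderiv ^^ Suc (Suc m)) (monom 1 (2 * Suc m) * pade_b m))) k =
      coeff (smult (fact (3 * Suc m)) (monom 1 m * [:1, -1:] ^ Suc m)) k"
  proof (cases "m \<le> k \<and> k - m \<le> Suc m")
    case True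
    then obtain j where j: "k = m + j" "j \<le> Suc m" by (metis le_add_diff_inverse)
    show ?thesis
      unfolding coeff_smult L R using pade_b_coeff_identity[OF j(2)] j
      by (simp add: coeff_pade_b mult_ac del: pochhammer_Suc fact_Suc binomial_Suc_Suc power_Suc of_nat_Suc of_nat_mult)
  next
    case False
    then show ?thesis
      unfolding coeff_smult L R by (auto simp: coeff_pade_b binomial_eq_0 not_le
          simp del: pochhammer_Suc fact_Suc binomial_Suc_Suc)
  qed
qed

lemma higher_pderiv_pade_c:
  "smult (fact m * fact (Suc m)) ((pderiv ^^ Suc (Suc m)) (monom 1 (2 * Suc m) * pade_c m)) =
   smult (fact (3 * Suc m)) (monom 1 (Suc m) * [:1, -1:] ^ m)"
proof (rule poly_eqI)
  fix k
  have L: "coeff ((pderiv ^^ Suc (Suc m)) (monom 1 (2 * Suc m) * pade_c m)) k =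
      pochhammer (of_nat (Suc k)) (Suc (Suc m)) * (if k < m then 0 else coeff (pade_c m) (k - m))"
    unfolding coeff_higher_pderiv coeff_monom_mult by auto
  have R: "coeff (monom 1 (Suc m) * [:1, -1:] ^ m) k =
      (if k < Suc m then 0 else (-1) ^ (k - Suc m) * int (m choose (k - Suc m)))"
    unfolding coeff_monom_mult coeff_one_minus_X_power by auto
  show "coeff (smult (fact m * fact (Suc m)) ((pderiv ^^ Suc (Suc m)) (monom 1 (2 * Suc m) * pade_c m))) k =
      coeff (smult (fact (3 * Suc m)) (monom 1 (Suc m) * [:1, -1:] ^ m)) k"
  proof (cases "Suc m \<le> k \<and> k - Suc m \<le> m")
    case True
    then obtain j where j: "k = Suc m + j" "j \<le> m" by (metis le_add_diff_inverse)
    have "k - m = Suc j" using j by simp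
    then show ?thesis
      unfolding coeff_smult L R using pade_c_coeff_identity[OF j(2)] j
      by (simp add: coeff_pade_c_Suc mult_ac del: pochhammer_Suc fact_Suc binomial_Suc_Suc power_Suc of_nat_Suc of_nat_mult)
  next
    case False
    then consider "k < m" | "k = m" | "k - Suc m > m" by linarith
    then show ?thesis
    proof cases
      case 3
      then have "k - m = Suc (k - Suc m)" by simp
      then show ?thesis using 3
        unfolding coeff_smult L R by (simp add: coeff_pade_c_Suc binomial_eq_0
          del: pochhammer_Suc fact_Suc binomial_Suc_Suc)
    qed (unfold coeff_smult L R, simp_all add: coeff_pade_c_0)
  qed
qed

text \<open>Put n = Suc m. Reflection carries z^n (1 - z)^(n-1) to z^(n-1) (1 - z)^n, so the
  derivatives of order n + 1 of the two summands agree up to sign. Differentiating the reflected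
  summand gives the sign (-1)^(n+1), which with the prefactor (-1)^n makes them cancel.\<close>

lemma degree_pade_remainder:
  "degree (monom 1 (2 * Suc m) * pade_b m +
     smult ((-1) ^ Suc m) ([:1, -1:] ^ (2 * Suc m) * pcompose (pade_c m) [:1, -1:])) \<le> Suc m"
proof (rule degree_le_of_higher_pderiv_eq_0)
  define S T where "S = monom 1 (2 * Suc m) * pade_b m" and "T = monom 1 (2 * Suc m) * pade_c m"
  define K :: int where "K = fact m * fact (Suc m)"
  define J :: int where "J = fact (3 * Suc m)"
  have "K \<noteq> 0" by (simp add: K_def del: fact_Suc)
  have T: "[:1, -1:] ^ (2 * Suc m) * pcompose (pade_c m) [:1, -1:] = pcompose T [:1, -1:]"
    unfolding T_def pcompose_mult pcompose_monom ..
  have S': "smult K ((pderiv ^^ Suc (Suc m)) S) = smult J (monom 1 m * [:1, -1:] ^ Suc m)"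
    unfolding K_def J_def S_def by (rule higher_pderiv_pade_b)
  have "smult K (pcompose ((pderiv ^^ Suc (Suc m)) T) [:1, -1:]) =
      pcompose (smult J (monom 1 (Suc m) * [:1, -1:] ^ m)) [:1, -1:]"
    unfolding K_def J_def T_def higher_pderiv_pade_c[symmetric] by (rule pcompose_smult[symmetric])
  also have "\<dots> = smult J ([:1, -1:] ^ Suc m * monom 1 m)"
  proof -
    have "pcompose ([:1, -1:] ^ m) [:1, -1:] = (monom 1 m :: int poly)"
      using pcompose_reflect_reflect[of "monom 1 m"] by (simp only: pcompose_monom)
    then show ?thesis by (simp only: pcompose_smult pcompose_mult pcompose_monom)
  qed
  finally have T': "smult K (pcompose ((pderiv ^^ Suc (Suc m)) T) [:1, -1:]) =
      smult J (monom 1 m * [:1, -1:] ^ Suc m)" by (simp only: mult.commute)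
  have sgn: "(-1) ^ Suc m * (-1) ^ Suc (Suc m) = (-1 :: int)"
    by (simp flip: power_mult_distrib)
  have "smult K ((pderiv ^^ Suc (Suc m)) (S + smult ((-1) ^ Suc m) (pcompose T [:1, -1:]))) =
     smult K ((pderiv ^^ Suc (Suc m)) S) +
     smult ((-1) ^ Suc m * (-1) ^ Suc (Suc m)) (smult K (pcompose ((pderiv ^^ Suc (Suc m)) T) [:1, -1:]))"
    unfolding higher_pderiv_add higher_pderiv_smult higher_pderiv_reflect smult_add_right smult_smult
    by (simp only: mult_ac)
  also have "\<dots> = 0" unfolding S' T' sgn by simp
  finally have "(pderiv ^^ Suc (Suc m)) (S + smult ((-1) ^ Suc m) (pcompose T [:1, -1:])) = 0"
    using \<open>K \<noteq> 0\<close> by (simp only: smult_eq_0_iff) blast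
  then show "(pderiv ^^ Suc (Suc m)) (monom 1 (2 * Suc m) * pade_b m +
     smult ((-1) ^ Suc m) ([:1, -1:] ^ (2 * Suc m) * pcompose (pade_c m) [:1, -1:])) = 0"
    by (simp only: T S_def)
qed

text \<open>Vandermonde convolution with upper entries -n and 3n, where n = Suc m, since (-1)^j
  times n-1+j over j is the generalized binomial coefficient of -n over j.\<close>

lemma poly_pade_b_1: "poly (pade_b m) 1 = int (2 * Suc m choose Suc m)"
proof -
  have "real_of_int (poly (pade_b m) 1) =
      (\<Sum>j\<le>Suc m. (-1) ^ j * (real (3 * Suc m choose (Suc m - j)) * real (m + j choose j)))"
    unfolding pade_b_def poly_sum poly_monom by simp
  also have "\<dots> = (\<Sum>j\<le>Suc m. ((- real (Suc m)) gchoose j) * (real (3 * Suc m) gchoose (Suc m - j)))"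
  proof (rule sum.cong)
    fix j assume "j \<in> {..Suc m}"
    have "(- real (Suc m)) gchoose j = (-1) ^ j * (real (m + j) gchoose j)"
      by (subst gbinomial_minus) (simp add: add_ac)
    then show "(-1) ^ j * (real (3 * Suc m choose (Suc m - j)) * real (m + j choose j)) =
        ((- real (Suc m)) gchoose j) * (real (3 * Suc m) gchoose (Suc m - j))"
      by (simp only: binomial_gbinomial mult_ac)
  qed simp
  also have "\<dots> = (- real (Suc m) + real (3 * Suc m)) gchoose Suc m"
    using gbinomial_Vandermonde[of "- real (Suc m)" "real (3 * Suc m)" "Suc m"]
    by (simp only: atMost_atLeast0)
  also have "- real (Suc m) + real (3 * Suc m) = real (2 * Suc m)" by simp
  finally show ?thesis unfolding binomial_gbinomial[symmetric] by linarith
qed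

lemma l1_norm_pade_b: "l1_norm (pade_b m) \<le> 2 ^ (6 * Suc m)"
proof -
  \<comment> \<open>With n = Suc m the binomials are at most 2^(3n) and 2^(2n); the n + 1 summands
    account for one more factor 2^n.\<close>
  have "l1_norm (pade_b m) \<le> (\<Sum>j\<le>Suc m. 2 ^ (5 * Suc m))"
    unfolding l1_norm_eq[OF degree_pade_b]
  proof (rule sum_mono)
    fix j assume j: "j \<in> {..Suc m}"
    have "(3 * Suc m choose (Suc m - j)) * (m + j choose j) \<le> 2 ^ (3 * Suc m) * 2 ^ (m + j)"
      by (intro mult_mono binomial_le_pow2) auto
    also have "\<dots> \<le> 2 ^ (3 * Suc m) * 2 ^ (2 * Suc m)"
      using j by (intro mult_left_mono power_increasing) auto
    also have "\<dots> = 2 ^ (5 * Suc m)" unfolding power_add[symmetric] by simp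
    finally have "int ((3 * Suc m choose (Suc m - j)) * (m + j choose j)) \<le> int (2 ^ (5 * Suc m))"
      by (simp only: of_nat_le_iff)
    then show "\<bar>coeff (pade_b m) j\<bar> \<le> 2 ^ (5 * Suc m)"
      using j by (simp add: coeff_pade_b abs_mult del: of_nat_mult)
  qed
  also have "\<dots> = int (Suc (Suc m)) * 2 ^ (5 * Suc m)" by simp
  also have "\<dots> \<le> 2 ^ Suc m * 2 ^ (5 * Suc m)"
  proof (rule mult_right_mono)
    have "Suc (Suc m) \<le> 2 ^ Suc m" by (rule Suc_leI, rule less_exp)
    then show "int (Suc (Suc m)) \<le> 2 ^ Suc m" by (metis of_nat_le_iff of_nat_numeral of_nat_power)
  qed simp
  also have "\<dots> = 2 ^ (6 * Suc m)" unfolding power_add[symmetric] by simp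
  finally show ?thesis .
qed

lemma l1_norm_pade_c: "l1_norm (pade_c m) \<le> 2 ^ (6 * Suc m)"
proof -
  have "l1_norm (pade_c m) \<le> (\<Sum>j\<le>Suc m. 2 ^ (5 * Suc m))"
    unfolding l1_norm_eq[OF degree_pade_c]
  proof (rule sum_mono)
    fix i assume i: "i \<in> {..Suc m}"
    show "\<bar>coeff (pade_c m) i\<bar> \<le> 2 ^ (5 * Suc m)"
    proof (cases i)
      case 0
      then show ?thesis by (simp add: coeff_pade_c_0)
    next
      case (Suc j)
      then have j: "j \<le> m" using i by simp
      have "(3 * Suc m choose (m - j)) * (Suc m + j choose j) \<le> 2 ^ (3 * Suc m) * 2 ^ (Suc m + j)"
        by (intro mult_mono binomial_le_pow2) auto
      also have "\<dots> \<le> 2 ^ (3 * Suc m) * 2 ^ (2 * Suc m)"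
        using j by (intro mult_left_mono power_increasing) auto
      also have "\<dots> = 2 ^ (5 * Suc m)" unfolding power_add[symmetric] by simp
      finally have "int ((3 * Suc m choose (m - j)) * (Suc m + j choose j)) \<le> int (2 ^ (5 * Suc m))"
        by (simp only: of_nat_le_iff)
      then show ?thesis
        using j by (simp add: Suc coeff_pade_c_Suc abs_mult del: of_nat_mult)
    qed
  qed
  also have "\<dots> = int (Suc (Suc m)) * 2 ^ (5 * Suc m)" by simp
  also have "\<dots> \<le> 2 ^ Suc m * 2 ^ (5 * Suc m)"
  proof (rule mult_right_mono)
    have "Suc (Suc m) \<le> 2 ^ Suc m" by (rule Suc_leI, rule less_exp)
    then show "int (Suc (Suc m)) \<le> 2 ^ Suc m" by (metis of_nat_le_iff of_nat_numeral of_nat_power)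
  qed simp
  also have "\<dots> = 2 ^ (6 * Suc m)" unfolding power_add[symmetric] by simp
  finally show ?thesis .
qed

text \<open>Origin of the 11: \<open>pade_b\<close> and \<open>pade_c\<close> have length at most
  2^(6n), and reflection adds n to the exponent. The remainder P0 reaches 10n through the factor (1
  - X)^(2n) and the sum of two terms, and is itself reflected once more.\<close>

definition pade_form :: "nat \<Rightarrow> int poly \<Rightarrow> int poly \<Rightarrow> int poly \<Rightarrow> bool" where
  "pade_form n P0 P1 P2 \<longleftrightarrow> (\<forall>P\<in>{P0, P1, P2}. degree P \<le> n \<and> l1_norm P \<le> 2 ^ (11 * n)) \<and>
     P0 + monom 1 (2 * n) * P1 + [:1, -1:] ^ (2 * n) * P2 = 0"

lemma l1_norm_pade_c_reflect: "l1_norm (pcompose (pade_c m) [:1, -1:]) \<le> 2 ^ (7 * Suc m)"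
proof -
  have "l1_norm (pcompose (pade_c m) [:1, -1:]) \<le> 2 ^ Suc m * l1_norm (pade_c m)"
    by (rule l1_norm_reflect[OF degree_pade_c])
  also have "\<dots> \<le> 2 ^ Suc m * 2 ^ (6 * Suc m)"
    using l1_norm_pade_c by (rule mult_left_mono) simp
  also have "\<dots> = 2 ^ (7 * Suc m)" unfolding power_add[symmetric] by simp
  finally show ?thesis .
qed

text \<open>The substitution \<open>z \<mapsto> 1 - z\<close> turns one approximant into another. Their \<open>2 \<times> 2\<close> minor \<open>D\<close> is
  constant because \<open>z\<^sup>2\<^sup>n D\<close> has degree at most \<open>2n\<close>.\<close>

lemma pade_forms_exist:
  assumes "n > 0"
  shows "\<exists>P0 P1 P2 Q0 Q1 Q2 D. pade_form n P0 P1 P2 \<and> pade_form n Q0 Q1 Q2 \<and>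
    P1 * Q2 - P2 * Q1 = [:D:] \<and> D \<noteq> 0"
proof -
  obtain m where n: "n = Suc m" using assms by (metis gr0_implies_Suc)
  define r where "r p = pcompose p [:1, -1 :: int:]" for p :: "int poly"
  have rr: "r (r p) = p" for p unfolding r_def by (rule pcompose_reflect_reflect)
  have r_add: "r (p + q) = r p + r q" and r_mult: "r (p * q) = r p * r q" for p q
    by (simp_all add: r_def pcompose_add pcompose_mult)
  have r_monom: "r (monom 1 k) = [:1, -1:] ^ k" for k unfolding r_def by (rule pcompose_monom)
  have r_power: "r ([:1, -1:] ^ k) = monom 1 k" for k
    using rr[of "monom 1 k"] by (simp only: r_monom)
  have r_smult: "r (smult c p) = smult c (r p)" for c p by (simp add: r_def pcompose_smult)
  have r_degree: "degree (r p) = degree p" for p by (simp add: r_def degree_pcompose)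
  define b c where "b = pade_b m" and "c = pade_c m"
  define s :: int where "s = (-1) ^ n"
  have s: "s * s = 1" "\<bar>s\<bar> = 1" by (simp_all add: s_def power_abs flip: power_mult_distrib)
  define P2 where "P2 = smult s (r c)"
  define P0 where "P0 = - (monom 1 (2 * n) * b + [:1, -1:] ^ (2 * n) * P2)"
  have id: "P0 + monom 1 (2 * n) * b + [:1, -1:] ^ (2 * n) * P2 = 0"
    by (simp add: P0_def)
  have deg: "degree b \<le> n" "degree c \<le> n" "degree P2 \<le> n" "degree P0 \<le> n"
  proof -
    show "degree b \<le> n" "degree c \<le> n" by (simp_all only: b_def c_def n degree_pade_b degree_pade_c)
    then show "degree P2 \<le> n" using degree_smult_le[of s "r c"] by (simp add: P2_def r_degree)
    have "P0 = - (monom 1 (2 * n) * b + smult ((-1) ^ n) ([:1, -1:] ^ (2 * n) * pcompose c [:1, -1:]))"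
      unfolding P0_def P2_def s_def r_def by (simp only: mult_smult_right)
    then show "degree P0 \<le> n"
      using degree_pade_remainder[of m] by (simp only: degree_minus n b_def c_def)
  qed
  have norm: "l1_norm b \<le> 2 ^ (6 * n)" "l1_norm c \<le> 2 ^ (6 * n)" "l1_norm P2 \<le> 2 ^ (7 * n)"
    using l1_norm_pade_b[of m] l1_norm_pade_c[of m] l1_norm_pade_c_reflect[of m]
    by (simp_all only: P2_def b_def c_def n r_def l1_norm_smult s(2)[unfolded n] s(2) mult_1_left)
  have "l1_norm ([:1, -1:] ^ k * p) \<le> 2 ^ k * l1_norm p" for k and p :: "int poly"
  proof (induction k)
    case (Suc k)
    have "l1_norm ([:1, -1:] * ([:1, -1:] ^ k * p)) \<le> l1_norm [:1, -1:] * l1_norm ([:1, -1:] ^ k * p)"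
      by (rule l1_norm_mult)
    then show ?case using Suc.IH by (simp only: power_Suc mult.assoc) simp
  qed simp
  note pow = this
  have P0: "l1_norm P0 \<le> 2 ^ (10 * n)"
  proof -
    have "l1_norm P0 = l1_norm (monom 1 (2 * n) * b + [:1, -1:] ^ (2 * n) * P2)"
      unfolding P0_def by (rule l1_norm_uminus)
    also have "\<dots> \<le> l1_norm b + 2 ^ (2 * n) * l1_norm P2"
      using l1_norm_add[of "monom 1 (2 * n) * b" "[:1, -1:] ^ (2 * n) * P2"] pow[of "2 * n" P2]
      by (simp add: l1_norm_monom_mult)
    also have "\<dots> \<le> 2 ^ (6 * n) + 2 ^ (2 * n) * 2 ^ (7 * n)"
      using norm by (intro add_mono mult_left_mono) auto
    also have "\<dots> \<le> 2 ^ (9 * n) + 2 ^ (9 * n)"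
      unfolding power_add[symmetric] by (intro add_mono power_increasing) auto
    also have "\<dots> = 2 ^ (Suc (9 * n))" by simp
    also have "\<dots> \<le> 2 ^ (10 * n)" using assms by (intro power_increasing) auto
    finally show ?thesis .
  qed
  have le: "p \<le> 2 ^ (11 * n)" if "p \<le> 2 ^ (k * n)" "k \<le> 11" for p :: int and k
  proof -
    have "(2::int) ^ (k * n) \<le> 2 ^ (11 * n)" using that(2) by (intro power_increasing) auto
    then show ?thesis using that(1) by linarith
  qed
  have rle: "l1_norm (r p) \<le> 2 ^ (11 * n)" if "l1_norm p \<le> 2 ^ (10 * n)" "degree p \<le> n" for p
  proof -
    have "l1_norm (r p) \<le> 2 ^ n * l1_norm p" unfolding r_def by (rule l1_norm_reflect[OF that(2)])
    also have "\<dots> \<le> 2 ^ n * 2 ^ (10 * n)" using that(1) by (rule mult_left_mono) simp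
    also have "\<dots> = 2 ^ (11 * n)" unfolding power_add[symmetric] by simp
    finally show ?thesis .
  qed
  have b10: "l1_norm b \<le> 2 ^ (10 * n)"
  proof -
    have "(2::int) ^ (6 * n) \<le> 2 ^ (10 * n)" by (intro power_increasing) auto
    then show ?thesis using norm(1) by linarith
  qed
  have form1: "pade_form n P0 b P2"
    unfolding pade_form_def using deg id le[OF P0] le[OF norm(1)] le[OF norm(3)] by simp
  have rP2: "r P2 = smult s c" by (simp add: P2_def r_smult rr)
  \<comment> \<open>Reflection exchanges X^(2n) and (1 - X)^(2n), so the last two coefficients
    change places.\<close>
  have id2: "r P0 + monom 1 (2 * n) * smult s c + [:1, -1:] ^ (2 * n) * r b = 0"
  proof -
    have "r (P0 + monom 1 (2 * n) * b + [:1, -1:] ^ (2 * n) * P2) = 0"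
      unfolding id by (simp add: r_def)
    then show ?thesis by (simp only: r_add r_mult r_monom r_power rP2 add_ac)
  qed
  have form2: "pade_form n (r P0) (smult s c) (r b)"
  proof -
    have "degree (smult s c) \<le> n" using degree_smult_le[of s c] deg(2) by linarith
    moreover have "l1_norm (smult s c) \<le> 2 ^ (11 * n)"
      using le[OF norm(2)] by (simp add: l1_norm_smult s)
    ultimately show ?thesis
      unfolding pade_form_def using deg id2 rle[OF P0] rle[OF b10] by (simp add: r_degree)
  qed
  define D where "D = b * r b - P2 * smult s c"
  \<comment> \<open>A column operation: each relation trades X^(2n) times its middle coefficient for
    its first one, and the terms with (1 - X)^(2n) cancel.\<close>
  have "monom 1 (2 * n) * D = r P0 * P2 - P0 * r b"
  proof -
    have 1: "monom 1 (2 * n) * b = - P0 - [:1, -1:] ^ (2 * n) * P2"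
      by (simp add: P0_def)
    have 2: "monom 1 (2 * n) * smult s c = - r P0 - [:1, -1:] ^ (2 * n) * r b"
      using id2 by (simp only: eq_neg_iff_add_eq_0 eq_diff_eq add_ac)
    have "monom 1 (2 * n) * D = (monom 1 (2 * n) * b) * r b - P2 * (monom 1 (2 * n) * smult s c)"
      by (simp only: D_def right_diff_distrib mult_ac)
    then show ?thesis unfolding 1 2 by (simp only: algebra_simps)
  qed
  moreover have "degree (r P0 * P2 - P0 * r b) \<le> 2 * n"
  proof (rule degree_diff_le)
    show "degree (r P0 * P2) \<le> 2 * n"
      using degree_mult_le[of "r P0" P2] deg by (simp add: r_degree)
    show "degree (P0 * r b) \<le> 2 * n"
      using degree_mult_le[of P0 "r b"] deg by (simp add: r_degree)
  qed
  ultimately have "degree (monom 1 (2 * n) * D) \<le> 2 * n" by simp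
  then have "degree D = 0"
    by (cases "D = 0") (simp_all add: degree_mult_eq degree_monom_eq)
  then obtain d where d: "D = [:d:]" by (metis degree_eq_zeroE)
  \<comment> \<open>At 0 the term with c drops out, which leaves b(0) b(1), a product of two
    binomial coefficients.\<close>
  have "d = poly D 0" by (simp add: d)
  also have "\<dots> = poly b 0 * poly b 1 - s * s * (poly c 1 * poly c 0)"
    by (simp add: D_def P2_def r_def poly_pcompose)
  also have "poly c 0 = 0" by (simp add: c_def poly_0_coeff_0 coeff_pade_c_0)
  also have "poly b 0 = int (3 * Suc m choose Suc m)" by (simp add: b_def poly_0_coeff_0 coeff_pade_b)
  also have "poly b 1 = int (2 * Suc m choose Suc m)" by (simp only: b_def poly_pade_b_1)
  finally have "d \<noteq> 0" by (simp del: binomial_Suc_Suc)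
  moreover have "b * r b - P2 * smult s c = [:d:]" using d by (simp only: D_def)
  ultimately show ?thesis using form1 form2 by (intro exI conjI)
qed

section \<open>The unit equation\<close>

lemma weil_height_nonneg:
  assumes "algebraic z"
  shows "weil_height z \<ge> 0"
proof -
  have "lead_coeff (min_int_poly z) > 0"
    using min_int_poly_is_min[OF assms] by (simp add: is_min_int_poly_def)
  then have "ln (real_of_int (lead_coeff (min_int_poly z))) \<ge> 0" by simp
  then show ?thesis
    unfolding weil_height_def by (intro divide_nonneg_nonneg add_nonneg_nonneg sum_nonneg) auto
qed

text \<open>Numerator x y and denominator 1 are monomials of degree at most 1 in x and y, with
  coefficient sum 1, so the constant \<open>ln L\<close> vanishes.\<close>

lemma weil_height_mult:
  assumes "algebraic x" "algebraic y"
  shows "weil_height (x * y) \<le> weil_height x + weil_height y"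
  using weil_height_rational_function[of x y 1 "x * y" "{(0, 0, 0), (1, 1, 0)}" 1 1 0
      "\<lambda>e. if e = (0, 0, 0) then 1 else 0" "\<lambda>e. if e = (1, 1, 0) then 1 else 0" 1]
    assms algebraic_mult[OF assms] by auto

lemma weil_height_inverse:
  assumes "algebraic x"
  shows "weil_height (inverse x) \<le> weil_height x"
proof (cases "x = 0")
  case False
  then show ?thesis
    using weil_height_rational_function[of x 1 1 "inverse x" "{(0, 0, 0), (1, 0, 0)}" 1 0 0
      "\<lambda>e. if e = (1, 0, 0) then 1 else 0" "\<lambda>e. if e = (0, 0, 0) then 1 else 0" 1] assms
    by auto
qed simp

lemma weil_height_1: "weil_height 1 = 0"
proof (rule antisym)
  show "weil_height 1 \<le> 0"
    using weil_height_rational_function[of 1 1 1 1 "{(0, 0, 0)}" 0 0 0 "\<lambda>_. 1" "\<lambda>_. 1" 1] by auto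
qed (simp add: weil_height_nonneg)

lemma algebraic_power:
  fixes x :: complex
  shows "algebraic x \<Longrightarrow> algebraic (x ^ n)"
  by (induction n) (auto intro: algebraic_mult)

lemma algebraic_divide:
  fixes x y :: complex
  assumes "algebraic x" "algebraic y"
  shows "algebraic (x / y)"
  using algebraic_mult[OF assms(1) algebraic_inverse[OF assms(2)]] by (simp add: divide_inverse)

lemma weil_height_power_le:
  assumes "algebraic x"
  shows "weil_height (x ^ n) \<le> real n * weil_height x"
proof (induction n)
  case (Suc n)
  have "weil_height (x ^ Suc n) \<le> weil_height x + weil_height (x ^ n)"
    using weil_height_mult[OF assms algebraic_power[OF assms]] by simp
  then show ?case using Suc by (simp add: distrib_right)
qed (simp add: weil_height_1)

text \<open>Subadditivity gives no lower bound. Here the leading coefficient A belonging to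
  \<open>x ^ n\<close> is replaced by its real n-th root N, which serves for x because integrality
  can be tested on n-th powers (\<open>integral_el_root\<close>).\<close>

lemma weil_height_power_ge:
  assumes "algebraic x" "n > 0"
  shows "real n * weil_height x \<le> weil_height (x ^ n)"
proof -
  define W where "W = conjugates x"
  have fin: "finite W" using min_int_poly_factorization(1)[OF assms(1)] by (simp add: W_def)
  define X :: "rat poly" where "X = [:0, 1:]"
  have X: "ev X w = w" for w by (simp add: X_def)
  obtain P :: "int poly" where P: "lead_coeff P > 0"
    "map_poly of_int P = smult (of_int (lead_coeff P)) (\<Prod>w\<in>W. [:- (w ^ n), 1:])"
    "real (card W) * weil_height (x ^ n) =
       ln (real_of_int (lead_coeff P)) + (\<Sum>w\<in>W. ln (max 1 (cmod (w ^ n))))"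
    using field_height[OF assms(1), of "X ^ n"] unfolding ev_power X W_def by metis
  define A where "A = lead_coeff P"
  have A: "A > 0" using P(1) by (simp only: A_def)
  define N where "N = root n (real_of_int A)"
  have N: "N > 0" "N ^ n = real_of_int A" using A assms(2) by (simp_all add: N_def)
  define pc qc :: "nat \<Rightarrow> int" where "pc e = (if e = 1 then 1 else 0)" and "qc e = (if e = 0 then 1 else 0)" for e
  have p: "(\<Sum>e\<in>{0, 1}. smult (of_int (pc e)) (X ^ e)) = X"
    and q: "(\<Sum>e\<in>{0, 1}. smult (of_int (qc e)) (X ^ e)) = 1" by (simp_all add: pc_def qc_def)
  have "real (card (conjugates x)) * weil_height (ev X x) \<le> ln N +
      (\<Sum>w\<in>conjugates x. ln (max (cmod (ev (\<Sum>e\<in>{0, 1}. smult (of_int (qc e)) (X ^ e)) w))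
         (cmod (ev (\<Sum>e\<in>{0, 1}. smult (of_int (pc e)) (X ^ e)) w))))"
  proof (rule height_quotient_bound[OF assms(1) _ N(1) assms(2)])
    show "N ^ n \<in> \<int>" by (simp add: N(2))
    show "ev (\<Sum>e\<in>{0, 1}. smult (of_int (qc e)) (X ^ e)) x \<noteq> 0" unfolding q by simp
    show "ev X x * ev (\<Sum>e\<in>{0, 1}. smult (of_int (qc e)) (X ^ e)) x =
        ev (\<Sum>e\<in>{0, 1}. smult (of_int (pc e)) (X ^ e)) x" unfolding p q by simp
    fix g assume g: "g \<in> PiE (conjugates x) (\<lambda>_. {0, 1 :: nat})"
    have "integral_el (of_int A ^ 1 * (\<Prod>w\<in>W. (w ^ n) ^ g w))"
    proof (rule integral_el_bounded_exponents[OF fin])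
      have "integral_el (coeff (map_poly of_int P) i)" for i by (simp add: coeff_map_poly)
      then show "integral_el (coeff (smult (of_int A) (\<Prod>w\<in>W. [:- (w ^ n), 1:])) i)" for i
        unfolding P(2) A_def .
      show "g w \<le> 1" if "w \<in> W" for w using g that by (fastforce simp: W_def PiE_iff)
    qed
    moreover have "(of_real N * (\<Prod>w\<in>W. w ^ g w)) ^ n = of_int A ^ 1 * (\<Prod>w\<in>W. (w ^ n) ^ g w)"
    proof -
      have "(of_real N :: complex) ^ n = of_int A" using N(2) by (metis of_real_of_int_eq of_real_power)
      moreover have "(\<Prod>w\<in>W. w ^ g w) ^ n = (\<Prod>w\<in>W. (w ^ n) ^ g w)"
        unfolding prod_power_distrib by (simp add: mult.commute flip: power_mult)
      ultimately show ?thesis by (simp add: power_mult_distrib)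
    qed
    ultimately have "integral_el ((of_real N * (\<Prod>w\<in>W. w ^ g w)) ^ n)" by simp
    then have "integral_el (of_real N * (\<Prod>w\<in>W. w ^ g w))" using assms(2) by (rule integral_el_root)
    then show "integral_el (of_real N * (\<Prod>w\<in>conjugates x. ev (X ^ g w) w))" by (simp add: X W_def)
  qed simp
  then have "real (card W) * weil_height x \<le> ln N + (\<Sum>w\<in>W. ln (max 1 (cmod w)))"
    unfolding p q by (simp add: X W_def)
  then have "real n * (real (card W) * weil_height x) \<le> real n * ln N + (\<Sum>w\<in>W. real n * ln (max 1 (cmod w)))"
    unfolding sum_distrib_left[symmetric] distrib_left[symmetric] by (rule mult_left_mono) simp
  also have "real n * ln N = ln (real_of_int A)"
    unfolding N(2)[symmetric] using N(1) by (simp add: ln_realpow)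
  also have "(\<Sum>w\<in>W. real n * ln (max 1 (cmod w))) = (\<Sum>w\<in>W. ln (max 1 (cmod (w ^ n))))"
  proof (rule sum.cong)
    fix w
    have "max 1 (cmod (w ^ n)) = max 1 (cmod w) ^ n"
      using power_le_one[of "cmod w" n] one_le_power[of "cmod w" n]
      by (cases "cmod w \<le> 1") (auto simp: norm_power max_def)
    then show "real n * ln (max 1 (cmod w)) = ln (max 1 (cmod (w ^ n)))" by (simp add: ln_realpow)
  qed simp
  finally have "real (card W) * (real n * weil_height x) \<le> real (card W) * weil_height (x ^ n)"
    by (simp add: P(3) A_def mult_ac)
  moreover have "card W > 0" using card_conjugates_pos[OF assms(1)] by (simp add: W_def)
  ultimately show ?thesis by simp
qed

lemma sum_atMost_1_1:
  "(\<Sum>(i, j, k)\<in>{..n} \<times> {..1::nat} \<times> {..1::nat}. f i j k) =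
     (\<Sum>i\<le>n. f i 0 0 + f i 0 1 + f i 1 0 + (f i 1 1 :: 'a :: comm_monoid_add))"
proof -
  have "{..1::nat} \<times> {..1::nat} = {(0, 0), (0, 1), (1, 0), (1, 1)}" by auto
  then show ?thesis by (simp add: sum.cartesian_product[symmetric] add_ac flip: sum.cartesian_product)
qed

text \<open>The unit equation satisfied by \<open>(\<epsilon>, \<delta>)\<close> and a Pade form at \<open>x\<close> are two linear equations for
  \<open>(1 : x\<^sup>2\<^sup>n : y\<^sup>2\<^sup>n)\<close>. One of the two Pade forms is independent of the unit equation, and then
  \<open>x\<^sup>2\<^sup>n\<close> is a quotient of \<open>2 \<times> 2\<close> minors.\<close>

lemma weil_height_unit_equation:
  assumes "algebraic x" "algebraic \<epsilon>" "algebraic \<delta>"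
    and "x + y = 1" "\<epsilon> * x ^ (2 * n) + \<delta> * y ^ (2 * n) = 1" "n > 0"
  shows "real n * weil_height x \<le> weil_height \<epsilon> + weil_height \<delta> + 12 * real n"
proof -
  define X Y where "X = x ^ (2 * n)" and "Y = y ^ (2 * n)"
  have XY: "\<epsilon> * X + \<delta> * Y = 1" using assms(5) by (simp add: X_def Y_def)
  define v where "v P = poly (map_poly of_int P) x" for P :: "int poly"
  have v_mult: "v (P * Q) = v P * v Q" for P Q by (simp add: v_def map_poly_of_int_mult)
  have v_add: "v (P + Q) = v P + v Q" for P Q
  proof -
    have "map_poly of_int (P + Q) = (map_poly of_int P + map_poly of_int Q :: complex poly)"
      by (rule poly_eqI) (simp add: coeff_map_poly)
    then show ?thesis by (simp add: v_def)
  qed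
  have v_power: "v (P ^ k) = v P ^ k" for P k by (simp add: v_def map_poly_of_int_power)
  have relation: "v P0 + X * v P1 + Y * v P2 = 0" if "pade_form n P0 P1 P2" for P0 P1 P2
  proof -
    have "v (monom 1 (2 * n)) = X" by (simp add: v_def map_poly_monom poly_monom X_def)
    moreover have "v ([:1, -1:] ^ (2 * n)) = Y"
    proof -
      have "v [:1, -1:] = y" using assms(4) by (simp add: v_def map_poly_pCons algebra_simps)
      then show ?thesis by (simp add: v_power Y_def)
    qed
    moreover have "v (P0 + monom 1 (2 * n) * P1 + [:1, -1:] ^ (2 * n) * P2) = 0"
      using that by (simp add: pade_form_def v_def)
    ultimately show ?thesis by (simp only: v_add v_mult)
  qed
  have minors: "X * (\<delta> * v P1 - \<epsilon> * v P2) = - (\<delta> * v P0 + v P2)"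
    "Y * (\<delta> * v P1 - \<epsilon> * v P2) = \<epsilon> * v P0 + v P1" if "pade_form n P0 P1 P2" for P0 P1 P2
    using relation[OF that] XY by algebra+
  obtain P0 P1 P2 Q0 Q1 Q2 D where PQ: "pade_form n P0 P1 P2" "pade_form n Q0 Q1 Q2"
    "P1 * Q2 - P2 * Q1 = [:D:]" "D \<noteq> 0"
    using pade_forms_exist[OF assms(6)] by blast
  \<comment> \<open>If both minors vanish, the values at x of both forms are multiples of (1,
    -\<epsilon>, -\<delta>), and the determinant D of their last two columns is 0.\<close>
  have "\<exists>R0 R1 R2. pade_form n R0 R1 R2 \<and> \<delta> * v R1 - \<epsilon> * v R2 \<noteq> 0"
  proof (rule ccontr)
    assume "\<not> ?thesis"
    then have "\<delta> * v P1 - \<epsilon> * v P2 = 0" "\<delta> * v Q1 - \<epsilon> * v Q2 = 0" using PQ(1,2) by blast+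
    then have "v P2 = - (\<delta> * v P0)" "v P1 = - (\<epsilon> * v P0)" "v Q2 = - (\<delta> * v Q0)" "v Q1 = - (\<epsilon> * v Q0)"
      using minors[OF PQ(1)] minors[OF PQ(2)] by algebra+
    then have "v P1 * v Q2 = v P2 * v Q1" by simp
    moreover have "v (P1 * Q2) = v ([:D:] + P2 * Q1)" using PQ(3) by (simp add: algebra_simps flip: PQ(3))
    ultimately show False using PQ(4) by (simp add: v_mult v_add) (simp add: v_def map_poly_pCons)
  qed
  then obtain R0 R1 R2 where R: "pade_form n R0 R1 R2" and nz: "\<delta> * v R1 - \<epsilon> * v R2 \<noteq> 0" by blast
  have deg: "degree R0 \<le> n" "degree R1 \<le> n" "degree R2 \<le> n"
    and norm: "l1_norm R0 \<le> 2 ^ (11 * n)" "l1_norm R1 \<le> 2 ^ (11 * n)" "l1_norm R2 \<le> 2 ^ (11 * n)"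
    using R by (simp_all add: pade_form_def)
  have vsum: "v P = (\<Sum>i\<le>n. of_int (coeff P i) * x ^ i)" if "degree P \<le> n" for P
  proof -
    have "v P = (\<Sum>i\<le>degree P. of_int (coeff P i) * x ^ i)"
      by (simp add: v_def poly_altdef coeff_map_poly)
    also have "\<dots> = (\<Sum>i\<le>n. of_int (coeff P i) * x ^ i)"
      using that by (intro sum.mono_neutral_left) (auto simp: coeff_eq_0)
    finally show ?thesis .
  qed
  \<comment> \<open>The triple (i, j, k) holds the exponents of x, \<epsilon> and \<delta>. These
    are at most n, 1 and 1, which keeps the cost at n h(x) + h(\<epsilon>) + h(\<delta>).\<close>
  define pc where "pc = (\<lambda>(i, j :: nat, k :: nat). if j = 0 then (if k = 0 then - coeff R2 i else - coeff R0 i) else 0)"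
  define qc where "qc = (\<lambda>(i, j :: nat, k :: nat). if j = 0 then (if k = 0 then 0 else coeff R1 i)
    else (if k = 0 then - coeff R2 i else 0))"
  define E where "E = {..n} \<times> {..1::nat} \<times> {..1::nat}"
  define L :: real where "L = 2 * 2 ^ (11 * n)"
  have p: "(\<Sum>(i, j, k)\<in>E. of_int (pc (i, j, k)) * (x ^ i * \<epsilon> ^ j * \<delta> ^ k)) = - (\<delta> * v R0 + v R2)"
    unfolding E_def sum_atMost_1_1 pc_def vsum[OF deg(1)] vsum[OF deg(3)]
    by (simp add: sum.distrib sum_distrib_left sum_negf sum_subtractf mult_ac)
  have q: "(\<Sum>(i, j, k)\<in>E. of_int (qc (i, j, k)) * (x ^ i * \<epsilon> ^ j * \<delta> ^ k)) = \<delta> * v R1 - \<epsilon> * v R2"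
    unfolding E_def sum_atMost_1_1 qc_def vsum[OF deg(2)] vsum[OF deg(3)]
    by (simp add: sum.distrib sum_distrib_left sum_negf sum_subtractf mult_ac)
  have pL: "real_of_int (\<Sum>e\<in>E. \<bar>pc e\<bar>) \<le> L"
  proof -
    have "(\<Sum>e\<in>E. \<bar>pc e\<bar>) = (\<Sum>(i, j, k)\<in>E. \<bar>pc (i, j, k)\<bar>)" by (simp add: case_prod_beta)
    also have "\<dots> = l1_norm R2 + l1_norm R0"
      unfolding E_def sum_atMost_1_1 by (simp add: pc_def sum.distrib l1_norm_eq[OF deg(1)] l1_norm_eq[OF deg(3)])
    also have "\<dots> \<le> 2 * 2 ^ (11 * n)" using norm by simp
    finally show ?thesis unfolding L_def by (metis of_int_le_iff of_int_mult of_int_numeral of_int_power)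
  qed
  have qL: "real_of_int (\<Sum>e\<in>E. \<bar>qc e\<bar>) \<le> L"
  proof -
    have "(\<Sum>e\<in>E. \<bar>qc e\<bar>) = (\<Sum>(i, j, k)\<in>E. \<bar>qc (i, j, k)\<bar>)" by (simp add: case_prod_beta)
    also have "\<dots> = l1_norm R1 + l1_norm R2"
      unfolding E_def sum_atMost_1_1 by (simp add: qc_def sum.distrib l1_norm_eq[OF deg(2)] l1_norm_eq[OF deg(3)])
    also have "\<dots> \<le> 2 * 2 ^ (11 * n)" using norm by simp
    finally show ?thesis unfolding L_def by (metis of_int_le_iff of_int_mult of_int_numeral of_int_power)
  qed
  have "weil_height X \<le> real n * weil_height x + real 1 * weil_height \<epsilon> + real 1 * weil_height \<delta> + ln L"
  proof (rule weil_height_rational_function[OF assms(1-3) _ _ _ _ pL qL])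
    show "algebraic X" using algebraic_power[OF assms(1)] by (simp add: X_def)
    show "E \<subseteq> {..n} \<times> {..1} \<times> {..1}" by (simp add: E_def)
    show "(\<Sum>(i, j, k)\<in>E. of_int (qc (i, j, k)) * (x ^ i * \<epsilon> ^ j * \<delta> ^ k)) \<noteq> 0"
      unfolding q by (rule nz)
    show "X * (\<Sum>(i, j, k)\<in>E. of_int (qc (i, j, k)) * (x ^ i * \<epsilon> ^ j * \<delta> ^ k)) =
        (\<Sum>(i, j, k)\<in>E. of_int (pc (i, j, k)) * (x ^ i * \<epsilon> ^ j * \<delta> ^ k))"
      unfolding p q by (rule minors(1)[OF R])
  qed
  moreover have "ln L \<le> 12 * real n"
  proof -
    have "ln L = (11 * real n + 1) * ln 2"
      by (simp add: L_def ln_mult ln_realpow algebra_simps)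
    also have "\<dots> \<le> (12 * real n) * 1"
      using assms(6) ln_2_less_1 by (intro mult_mono) auto
    finally show ?thesis by simp
  qed
  moreover have "real (2 * n) * weil_height x \<le> weil_height X"
    unfolding X_def using assms(6) by (intro weil_height_power_ge[OF assms(1)]) simp
  ultimately show ?thesis by simp
qed

section \<open>The group in coordinates and the comparison of heights\<close>

lemma Gm_simps: "carrier Gm = {z. algebraic z \<and> z \<noteq> 0}" "x \<otimes>\<^bsub>Gm\<^esub> y = x * y" "\<one>\<^bsub>Gm\<^esub> = 1"
  by (simp_all add: Gm_def)

lemma carrier_Gm2: "x \<in> carrier Gm2 \<longleftrightarrow> algebraic (fst x) \<and> fst x \<noteq> 0 \<and> algebraic (snd x) \<and> snd x \<noteq> 0"
  by (cases x) (auto simp: Gm2_def DirProd_def Gm_simps)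

lemma inv_Gm: "x \<in> carrier Gm \<Longrightarrow> inv\<^bsub>Gm\<^esub> x = inverse x"
  using comm_group_Gm
  by (intro group.inv_equality) (auto simp: comm_group_def Gm_simps)

lemma pow_Gm2: "x [^]\<^bsub>Gm2\<^esub> (n :: nat) = (fst x ^ n, snd x ^ n)"
proof (induction n)
  case 0
  show ?case by (simp add: Gm2_def DirProd_def Gm_simps)
next
  case (Suc n)
  then show ?case by (cases x) (simp add: Gm2_def DirProd_def Gm_simps mult.commute)
qed

lemma height_dist_altdef:
  assumes "y \<in> carrier Gm2"
  shows "height_dist x y = max (weil_height (fst x / fst y)) (weil_height (snd x / snd y))"
proof -
  have "inv\<^bsub>Gm2\<^esub> y = (inverse (fst y), inverse (snd y))"
  proof -
    have "group Gm" using comm_group_Gm by (simp add: comm_group_def)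
    then show ?thesis
      using assms unfolding Gm2_def
      by (cases y) (auto simp: inv_DirProd inv_Gm)
  qed
  then show ?thesis
    by (cases x) (simp add: height_dist_def height2_def Gm2_def DirProd_def Gm_simps divide_inverse)
qed

theorem theorem1p2:
  fixes \<beta> :: "complex \<times> complex"
    and F :: "nat \<Rightarrow> complex \<times> complex"
  assumes "\<beta> \<in> carrier Gm2"
    and "non_torsion \<beta>"
    and "\<And>n. F n \<in> carrier Gm2"
    and "limsup (\<lambda>n. ereal (1 / real n * height_dist (F n) (\<beta> [^]\<^bsub>Gm2\<^esub> n)))
           < ereal (1 / 9 * height2 \<beta>)"
  shows "finite (range F \<inter> unit_line)"
proof (rule ccontr)
  assume "infinite (range F \<inter> unit_line)"
  define J where "J = {n. F n \<in> unit_line}"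
  have "range F \<inter> unit_line = F ` J" by (auto simp: J_def)
  with \<open>infinite _\<close> have "infinite J" by auto
  then have J_unbounded: "\<exists>n\<ge>m. n \<in> J" for m
    using infinite_nat_iff_unbounded_le by blast
  define H where "H = height2 \<beta>"
  define d where "d n = height_dist (F n) (\<beta> [^]\<^bsub>Gm2\<^esub> n)" for n
  \<comment> \<open>Truth values index the coordinates, so that \<open>\<not> i\<close> is the other
    one and a single argument covers both.\<close>
  define \<pi> where "\<pi> i = (if i then fst else snd :: complex \<times> complex \<Rightarrow> complex)" for i :: bool
  have \<beta>: "algebraic (\<pi> i \<beta>)" "\<pi> i \<beta> \<noteq> 0" for i
    using assms(1) by (simp_all add: carrier_Gm2 \<pi>_def)
  have F: "algebraic (\<pi> i (F n))" "\<pi> i (F n) \<noteq> 0" for i n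
    using assms(3)[of n] by (simp_all add: carrier_Gm2 \<pi>_def)
  have quot: "algebraic (\<pi> i (F n) / \<pi> i \<beta> ^ n)" for i n
    by (intro algebraic_divide algebraic_power F(1) \<beta>(1))
  have d: "weil_height (\<pi> i (F n) / \<pi> i \<beta> ^ n) \<le> d n" for i n
  proof -
    have "\<beta> [^]\<^bsub>Gm2\<^esub> n \<in> carrier Gm2"
      using assms(1) algebraic_power by (simp add: pow_Gm2 carrier_Gm2)
    from height_dist_altdef[OF this, of "F n"] show ?thesis by (simp add: d_def pow_Gm2 \<pi>_def)
  qed
  \<comment> \<open>A value strictly between the limsup and h(\<beta>) / 9 leaves the gap H - 9c
    that has to beat all error terms.\<close>
  obtain c where c: "limsup (\<lambda>n. ereal (1 / real n * d n)) < ereal c" "ereal c < ereal (1 / 9 * H)"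
    using ereal_dense2[OF assms(4)] unfolding d_def H_def by blast
  have "9 * c < H" using c(2) by simp
  have "eventually (\<lambda>n. ereal (1 / real n * d n) < ereal c) sequentially"
    by (rule Limsup_lessD[OF c(1)])
  then obtain m where m: "\<And>n. n \<ge> m \<Longrightarrow> 1 / real n * d n < c"
    unfolding eventually_sequentially by auto
  \<comment> \<open>The successor keeps the index positive, so that the division by n can be
    undone.\<close>
  define m0 where "m0 = Suc m"
  have dc: "d n \<le> c * real n" if "n \<ge> m0" for n
    using m[of n] that by (simp add: m0_def field_simps)
  have "d m0 \<ge> 0" using d weil_height_nonneg[OF quot] by (meson order_trans)
  then have "0 \<le> c * real m0" using dc[of m0] by simp
  then have "c \<ge> 0" by (simp add: m0_def zero_le_mult_iff)
  have h\<beta>: "weil_height (\<pi> i \<beta>) \<le> H" for i by (simp add: H_def height2_def \<pi>_def)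
  \<comment> \<open>The 24 makes the error 12 N of the height inequality at most half of the main
    term N (H - 9c) n.\<close>
  obtain n where n: "n \<in> J" "n \<ge> m0" "24 \<le> (H - 9 * c) * real n"
  proof -
    obtain k :: nat where "24 / (H - 9 * c) < real k" using reals_Archimedean2 by blast
    then have "24 \<le> (H - 9 * c) * real k"
      using \<open>9 * c < H\<close> by (simp add: pos_divide_less_eq mult.commute)
    moreover obtain n where n: "n \<in> J" "n \<ge> max m0 k" using J_unbounded by blast
    moreover have "(H - 9 * c) * real k \<le> (H - 9 * c) * real n"
      using n(2) \<open>9 * c < H\<close> by (intro mult_left_mono) auto
    ultimately show ?thesis using that[of n] by simp
  qed
  have "n > 0" using n(2) by (simp add: m0_def)
  \<comment> \<open>The other half must exceed the remaining error 4 (c + H) n, which does not grow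
    with N; this requires N > 8 (c + H) / (H - 9c).\<close>
  obtain N1 :: nat where N1: "8 * (c + H) / (H - 9 * c) < real N1" using reals_Archimedean2 by blast
  obtain n' where n': "n' \<in> J" "n' \<ge> max m0 (2 * n * Suc N1)" using J_unbounded by blast
  define N where "N = n' div (2 * n)"
  define r where "r = n' mod (2 * n)"
  have n'_eq: "n' = 2 * N * n + r"
    using div_mult_mod_eq[of n' "2 * n"] by (simp add: N_def r_def mult_ac)
  have "r < 2 * n" using \<open>n > 0\<close> by (simp add: r_def)
  have "N \<ge> Suc N1" using n'(2) \<open>n > 0\<close> by (simp add: N_def less_eq_div_iff_mult_less_eq mult_ac)
  then have "N > 0" by simp
  \<comment> \<open>Multiplied by the 2N-th powers of the coordinates of \<open>F n\<close>, these
    return the coordinates of \<open>F n'\<close>; thus \<open>F n'\<close> lying on the line is the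
    unit equation at \<open>F n\<close>.\<close>
  define \<epsilon> where "\<epsilon> i = \<pi> i (F n') / \<pi> i (F n) ^ (2 * N)" for i
  have \<epsilon>_alg: "algebraic (\<epsilon> i)" for i
    unfolding \<epsilon>_def by (intro algebraic_divide algebraic_power F(1))
  have h\<epsilon>: "weil_height (\<epsilon> i) \<le> c * real n' + 2 * real N * (c * real n) + 2 * real n * H" for i
  proof -
    define q where "q = \<pi> i (F n) / \<pi> i \<beta> ^ n"
    have q_alg: "algebraic (inverse q)" unfolding q_def by (rule algebraic_inverse[OF quot])
    have "inverse q ^ (2 * N) = \<pi> i \<beta> ^ (2 * N * n) / \<pi> i (F n) ^ (2 * N)"
      by (simp add: q_def power_divide mult.commute flip: power_mult)
    moreover have "\<pi> i \<beta> ^ n' = \<pi> i \<beta> ^ (2 * N * n) * \<pi> i \<beta> ^ r"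
      unfolding n'_eq by (rule power_add)
    \<comment> \<open>Three factors: the deviation of \<open>F n'\<close> from the power of \<beta>,
      the inverse 2N-th power of that of \<open>F n\<close>, and the leftover \<beta>^r with r <
      2n.\<close>
    ultimately have "\<epsilon> i = (\<pi> i (F n') / \<pi> i \<beta> ^ n') * (inverse q ^ (2 * N) * \<pi> i \<beta> ^ r)"
      using \<beta>(2)[of i] by (simp add: \<epsilon>_def)
    then have "weil_height (\<epsilon> i) \<le> weil_height (\<pi> i (F n') / \<pi> i \<beta> ^ n') +
        weil_height (inverse q ^ (2 * N) * \<pi> i \<beta> ^ r)"
      using weil_height_mult[OF quot algebraic_mult[OF algebraic_power[OF q_alg] algebraic_power[OF \<beta>(1)]]]
      by simp
    also have "weil_height (inverse q ^ (2 * N) * \<pi> i \<beta> ^ r) \<le>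
        weil_height (inverse q ^ (2 * N)) + weil_height (\<pi> i \<beta> ^ r)"
      by (rule weil_height_mult[OF algebraic_power[OF q_alg] algebraic_power[OF \<beta>(1)]])
    also have "weil_height (inverse q ^ (2 * N)) \<le> real (2 * N) * (c * real n)"
    proof -
      have "weil_height (inverse q) \<le> c * real n"
        using weil_height_inverse[OF quot, of i n] d[of i n] dc[OF n(2)] by (simp add: q_def)
      then show ?thesis
        using weil_height_power_le[OF q_alg, of "2 * N"] by (meson mult_left_mono of_nat_0_le_iff order_trans)
    qed
    also have "weil_height (\<pi> i \<beta> ^ r) \<le> real (2 * n) * H"
    proof -
      have "weil_height (\<pi> i \<beta> ^ r) \<le> real r * weil_height (\<pi> i \<beta>)" by (rule weil_height_power_le[OF \<beta>(1)])
      also have "\<dots> \<le> real (2 * n) * H"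
        using \<open>r < 2 * n\<close> h\<beta> weil_height_nonneg[OF \<beta>(1)] by (intro mult_mono) auto
      finally show ?thesis .
    qed
    also have "weil_height (\<pi> i (F n') / \<pi> i \<beta> ^ n') \<le> c * real n'"
      using d[of i n'] dc[of n'] n'(2) by simp
    finally show ?thesis by simp
  qed
  have line: "\<pi> i (F k) + \<pi> (\<not> i) (F k) = 1" if "k \<in> J" for i k
    using that by (cases i) (auto simp: J_def unit_line_def \<pi>_def add.commute)
  have upper: "real N * weil_height (\<pi> i (F n)) \<le> weil_height (\<epsilon> i) + weil_height (\<epsilon> (\<not> i)) + 12 * real N" for i
  proof (rule weil_height_unit_equation[OF F(1) \<epsilon>_alg \<epsilon>_alg line[OF n(1)] _ \<open>N > 0\<close>])
    show "\<epsilon> i * \<pi> i (F n) ^ (2 * N) + \<epsilon> (\<not> i) * \<pi> (\<not> i) (F n) ^ (2 * N) = 1"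
      using F(2) line[OF n'(1), of i] by (simp add: \<epsilon>_def)
  qed
  have lower: "real n * weil_height (\<pi> i \<beta>) \<le> weil_height (\<pi> i (F n)) + c * real n" for i
  proof -
    define q where "q = \<pi> i (F n) / \<pi> i \<beta> ^ n"
    have q_alg: "algebraic (inverse q)" unfolding q_def by (rule algebraic_inverse[OF quot])
    have "real n * weil_height (\<pi> i \<beta>) \<le> weil_height (\<pi> i \<beta> ^ n)"
      by (rule weil_height_power_ge[OF \<beta>(1) \<open>n > 0\<close>])
    also have "\<pi> i \<beta> ^ n = \<pi> i (F n) * inverse q" using F(2) by (simp add: q_def)
    also have "weil_height \<dots> \<le> weil_height (\<pi> i (F n)) + weil_height (inverse q)"
      by (rule weil_height_mult[OF F(1) q_alg])
    also have "weil_height (inverse q) \<le> c * real n"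
      using weil_height_inverse[OF quot, of i n] d[of i n] dc[OF n(2)] by (simp add: q_def)
    finally show ?thesis by simp
  qed
  \<comment> \<open>The comparison is made in the coordinate where \<beta> attains its
    height.\<close>
  have "weil_height (\<pi> True \<beta>) = H \<or> weil_height (\<pi> False \<beta>) = H"
    by (simp add: H_def height2_def \<pi>_def max_def)
  then obtain i where i: "weil_height (\<pi> i \<beta>) = H" by blast
  define R K where "R = real n" and "K = real N"
  have pos: "R > 0" "K > 0" using \<open>n > 0\<close> \<open>N > 0\<close> by (simp_all add: R_def K_def)
  have "K * (R * H - c * R) \<le> K * weil_height (\<pi> i (F n))"
    using lower[of i] pos by (intro mult_left_mono) (auto simp: i R_def)
  also have "\<dots> \<le> 2 * (c * real n' + 2 * K * (c * R) + 2 * R * H) + 12 * K"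
    using upper[of i] h\<epsilon>[of i] h\<epsilon>[of "\<not> i"] by (simp add: R_def K_def)
  also have "c * real n' \<le> c * (2 * K * R + 2 * R)"
    using \<open>c \<ge> 0\<close> \<open>r < 2 * n\<close> by (intro mult_left_mono) (auto simp: n'_eq R_def K_def)
  finally have "K * ((H - 9 * c) * R) \<le> 4 * (c + H) * R + 12 * K"
    by (simp add: algebra_simps)
  moreover have "12 * K \<le> K * ((H - 9 * c) * R) / 2"
    using mult_left_mono[OF n(3), of K] pos by (simp add: R_def)
  ultimately have "(K * (H - 9 * c)) * R \<le> (8 * (c + H)) * R"
    by (simp add: algebra_simps)
  then have "K * (H - 9 * c) \<le> 8 * (c + H)" using pos(1) by simp
  moreover have "8 * (c + H) < real N1 * (H - 9 * c)"
    using N1 \<open>9 * c < H\<close> by (simp add: pos_divide_less_eq)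
  moreover have "real N1 * (H - 9 * c) \<le> K * (H - 9 * c)"
    using \<open>N \<ge> Suc N1\<close> \<open>9 * c < H\<close> by (intro mult_right_mono) (auto simp: K_def)
  ultimately show False by linarith
qed

end
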